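(* Let $\mathfrak{X}$ be an association scheme of rank $4$ and diameter $2$ on $n\ge29$ vertices, with constituents ordered by degree, and suppose $k_2\le \varepsilon k_3/2$ for some $\varepsilon<10^{-11}$. Suppose that $k_2\le\frac{101}{100}k_1$ and that $X_2$ is strongly regular with smallest eigenvalue $-2$. Then $$q(X_{1,2})+\xi(X_{1,2})\le \frac{99}{100}(k_1+k_2).$$
   Context: An association scheme of rank $r$ on a finite vertex set $V$ ($|V|=n$) is a surjective map $c:V\times V\to\{0,1,\dots,r-1\}$ such that $c(u,v)=0$ iff $u=v$, $c(u,v)=c(v,u)$, and for all colors $i,j,t$ there is an integer $p^t_{i,j}$ such that whenever $c(u,v)=t$ there are exactly $p^t_{i,j}$ vertices $w$ with $c(u,w)=i$, $c(w,v)=j$. The constituent $X_i$ is the graph on $V$ with distinct $u,v$ adjacent iff $c(u,v)=i$; it is regular of degree $k_i=p^0_{i,i}$. $X_{1,2}$ is the graph on $V$ with $u,v$ adjacent iff $c(u,v)\in\{1,2\}$ (regular of degree $k_1+k_2$). The scheme has diameter $2$ if every $X_i$ ($i\ne0$) has diameter at most $2$ and some has diameter exactly $2$. Constituents are ordered by degree if $k_1\le k_2\le k_3$. For a graph $X$, $q(X)$ is the maximum number of common neighbours of two distinct vertices. For a $k$-regular graph with adjacency eigenvalues $k=\xi_1\ge\dots\ge\xi_n$, the zero-weight spectral radius is $\xi(X)=\max\{|\xi_i|:2\le i\le n\}$. *)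

theory Defs
  imports
    "Graph_Theory.Graph_Theory"
    "Jordan_Normal_Form.Spectral_Radius"
    "HOL-Library.Countable_Set"
begin

section \<open>Finite graphs\<close>

text \<open>Undirected graphs are symmetric loop-free digraphs, as in \<^theory>\<open>Graph_Theory.Digraph\<close>.
  In such a graph the out-degree of a vertex is its degree.\<close>

definition graph_diameter :: "('a, 'b) pre_digraph \<Rightarrow> ereal" where
  "graph_diameter G = (SUP (u, v) \<in> verts G \<times> verts G. wf_digraph.\<mu> G (\<lambda>_. 1) u v)"

definition common_neighbours :: "('a, 'b) pre_digraph \<Rightarrow> 'a \<Rightarrow> 'a \<Rightarrow> 'a set" where
  "common_neighbours G u v = {w \<in> verts G. u \<rightarrow>\<^bsub>G\<^esub> w \<and> v \<rightarrow>\<^bsub>G\<^esub> w}"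

definition max_common_neighbours :: "('a, 'b) pre_digraph \<Rightarrow> nat" where
  "max_common_neighbours G =
     Max {card (common_neighbours G u v) | u v. u \<in> verts G \<and> v \<in> verts G \<and> u \<noteq> v}"

text \<open>Complete and empty graphs are not excluded here. A constituent of an association scheme of
  rank at least 3 is neither, so the convention makes no difference for it.\<close>

definition strongly_regular :: "('a, 'b) pre_digraph \<Rightarrow> bool" where
  "strongly_regular G \<longleftrightarrow> (\<exists>k l m.
     (\<forall>u \<in> verts G. out_degree G u = k) \<and>
     (\<forall>u \<in> verts G. \<forall>v \<in> verts G. u \<noteq> v \<longrightarrow>
        card (common_neighbours G u v) = (if u \<rightarrow>\<^bsub>G\<^esub> v then l else m)))"

text \<open>For finite \<^term>\<open>V\<close>, \<^term>\<open>from_nat_into V\<close> enumerates \<^term>\<open>V\<close> bijectively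
  by \<^term>\<open>{..<card V}\<close>; the spectrum does not depend on the enumeration.\<close>

definition adjacency_matrix :: "('a, 'b) pre_digraph \<Rightarrow> real mat" where
  "adjacency_matrix G = mat (card (verts G)) (card (verts G))
     (\<lambda>(i, j). if from_nat_into (verts G) i \<rightarrow>\<^bsub>G\<^esub> from_nat_into (verts G) j then 1 else 0)"

text \<open>The eigenvalues with multiplicity, in descending order. For an undirected graph the matrix is
  real symmetric, so all roots of its characteristic polynomial are real and the list has length
  \<^term>\<open>card (verts G)\<close>.\<close>

definition adjacency_eigenvalues :: "('a, 'b) pre_digraph \<Rightarrow> real list" where
  "adjacency_eigenvalues G =
     rev (sorted_list_of_multiset (proots (char_poly (adjacency_matrix G))))"

definition smallest_eigenvalue :: "('a, 'b) pre_digraph \<Rightarrow> real" where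
  "smallest_eigenvalue G = Min (spectrum (adjacency_matrix G))"

text \<open>For a regular graph the discarded head of the list is the degree. Only one copy is discarded:
  if the degree is a multiple eigenvalue, the radius equals the degree.\<close>

definition zero_weight_spectral_radius :: "('a, 'b) pre_digraph \<Rightarrow> real" where
  "zero_weight_spectral_radius G = Max (abs ` set (tl (adjacency_eigenvalues G)))"

section \<open>Association schemes\<close>

locale association_scheme =
  fixes V :: "'a set" and c :: "'a \<Rightarrow> 'a \<Rightarrow> nat" and r :: nat
  assumes finite_vertices: "finite V"
    and surj_colors: "case_prod c ` (V \<times> V) = {0..<r}"
    and diagonal: "\<lbrakk>u \<in> V; v \<in> V\<rbrakk> \<Longrightarrow> c u v = 0 \<longleftrightarrow> u = v"
    and symmetric_colors: "\<lbrakk>u \<in> V; v \<in> V\<rbrakk> \<Longrightarrow> c u v = c v u"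
    and regularity: "\<lbrakk>i < r; j < r; t < r\<rbrakk> \<Longrightarrow>
      \<exists>p. \<forall>u \<in> V. \<forall>v \<in> V. c u v = t \<longrightarrow> card {w \<in> V. c u w = i \<and> c w v = j} = p"

definition intersection_number ::
    "'a set \<Rightarrow> ('a \<Rightarrow> 'a \<Rightarrow> nat) \<Rightarrow> nat \<Rightarrow> nat \<Rightarrow> nat \<Rightarrow> nat" where
  "intersection_number V c t i j =
     (THE p. \<forall>u \<in> V. \<forall>v \<in> V. c u v = t \<longrightarrow> card {w \<in> V. c u w = i \<and> c w v = j} = p)"

definition constituent_degree :: "'a set \<Rightarrow> ('a \<Rightarrow> 'a \<Rightarrow> nat) \<Rightarrow> nat \<Rightarrow> nat" where
  "constituent_degree V c i = intersection_number V c 0 i i"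

definition color_graph :: "'a set \<Rightarrow> ('a \<Rightarrow> 'a \<Rightarrow> nat) \<Rightarrow> nat set \<Rightarrow> 'a pair_pre_digraph" where
  "color_graph V c I =
     \<lparr>pverts = V, parcs = {(u, v). u \<in> V \<and> v \<in> V \<and> u \<noteq> v \<and> c u v \<in> I}\<rparr>"

lemma (in association_scheme) pair_graph_color_graph: "pair_graph (color_graph V c I)"
proof
  show "finite (parcs (color_graph V c I))"
    by (rule finite_subset[of _ "V \<times> V"]) (auto simp: color_graph_def finite_vertices)
  show "symmetric (with_proj (color_graph V c I))"
    by (auto simp: symmetric_def sym_def color_graph_def symmetric_colors)
qed (auto simp: color_graph_def finite_vertices)

abbreviation constituent :: "'a set \<Rightarrow> ('a \<Rightarrow> 'a \<Rightarrow> nat) \<Rightarrow> nat \<Rightarrow> 'a pair_pre_digraph" where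
  "constituent V c i \<equiv> color_graph V c {i}"

definition scheme_diameter_2 :: "'a set \<Rightarrow> ('a \<Rightarrow> 'a \<Rightarrow> nat) \<Rightarrow> nat \<Rightarrow> bool" where
  "scheme_diameter_2 V c r \<longleftrightarrow>
     (\<forall>i \<in> {1..<r}. graph_diameter (constituent V c i) \<le> 2) \<and>
     (\<exists>i \<in> {1..<r}. graph_diameter (constituent V c i) = 2)"

end

theory Submission
  imports Defs
begin

text \<open>
  Write \<open>p\<^sup>t\<^sub>i\<^sub>j\<close> for the intersection numbers. Strong regularity gives \<open>p\<^sup>1\<^sub>2\<^sub>2 = p\<^sup>3\<^sub>2\<^sub>2 = \<mu>\<close>. The
  restricted eigenvalues of \<open>X\<^sub>2\<close>, those of its zero-sum eigenvectors, are then the roots of a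
  quadratic: \<open>-2\<close> and \<open>\<theta> = (k\<^sub>2 - \<mu>) / 2\<close>, with \<open>2 p\<^sup>2\<^sub>2\<^sub>2 = k\<^sub>2 + \<mu> - 4\<close>. Since \<open>k\<^sub>3\<close> dwarfs \<open>k\<^sub>2\<close>, all
  \<open>p\<^sup>3\<^sub>i\<^sub>j\<close> with \<open>i, j \<in> {1, 2}\<close> are tiny compared to \<open>k\<^sub>2\<close>, so \<open>p\<^sup>2\<^sub>2\<^sub>2\<close> and \<open>\<theta>\<close> are about \<open>k\<^sub>2 / 2\<close>; no
  classification of the strongly regular graphs with smallest eigenvalue \<open>-2\<close> is needed. The crucial
  point is that \<open>p\<^sup>1\<^sub>1\<^sub>2\<close> is tiny too: otherwise \<open>X\<^sub>1\<close> would have a rational eigenvalue strictly between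
  0 and 1. Two vertices in relation 3 with a common \<open>X\<^sub>1\<close>-neighbour show that \<open>p\<^sup>1\<^sub>1\<^sub>1\<close> is at most about
  \<open>k\<^sub>1 / 2\<close>. Hence \<open>q(X\<^sub>1\<^sub>,\<^sub>2)\<close> is at most about \<open>k\<^sub>2 / 2\<close>, and so are all restricted eigenvalues of
  \<open>X\<^sub>1\<^sub>,\<^sub>2\<close> in absolute value, by the quadratic relations between the eigenvalues of \<open>X\<^sub>1\<close> and \<open>X\<^sub>2\<close> on a
  common eigenvector.
\<close>

section \<open>Matrices with constant column sums\<close>

definition zero_sum_compression :: "'a :: ring_1 mat \<Rightarrow> 'a mat" where
  "zero_sum_compression M =
     mat (dim_row M - 1) (dim_col M - 1) (\<lambda>(i, j). M $$ (Suc i, Suc j) - M $$ (Suc i, 0))"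

lemma zero_sum_compression_carrier:
  "M \<in> carrier_mat (Suc m) (Suc m) \<Longrightarrow> zero_sum_compression M \<in> carrier_mat m m"
  by (simp add: zero_sum_compression_def)

definition zero_sum_basis :: "nat \<Rightarrow> 'a :: ring_1 mat" where
  "zero_sum_basis n = mat n n (\<lambda>(i, j). if i = j then 1 else if i = 0 then - 1 else 0)"

definition zero_sum_coordinates :: "nat \<Rightarrow> 'a :: ring_1 mat" where
  "zero_sum_coordinates n = mat n n (\<lambda>(i, j). if i = j \<or> i = 0 then 1 else 0)"

lemma zero_sum_basis_carrier [simp]: "zero_sum_basis n \<in> carrier_mat n n"
  and zero_sum_coordinates_carrier [simp]: "zero_sum_coordinates n \<in> carrier_mat n n"
  by (simp_all add: zero_sum_basis_def zero_sum_coordinates_def)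

lemma zero_sum_basis_mult_coordinates:
  "zero_sum_basis (Suc m) * zero_sum_coordinates (Suc m) = (1\<^sub>m (Suc m) :: 'a :: ring_1 mat)"
proof (rule eq_matI)
  fix i j assume "i < dim_row (1\<^sub>m (Suc m) :: 'a mat)" "j < dim_col (1\<^sub>m (Suc m) :: 'a mat)"
  thus "(zero_sum_basis (Suc m) * zero_sum_coordinates (Suc m)) $$ (i, j) =
      (1\<^sub>m (Suc m) :: 'a mat) $$ (i, j)"
    by (cases i; cases j) (auto simp: zero_sum_basis_def zero_sum_coordinates_def scalar_prod_def
        sum.atLeast0_lessThan_Suc_shift if_distrib[of "\<lambda>x. x * _"] if_distrib[of uminus]
        cong: if_cong simp del: sum.op_ivl_Suc)
qed (auto simp: zero_sum_basis_def zero_sum_coordinates_def)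

text \<open>A matrix with constant column sums leaves the zero-sum vectors, the span of the \<open>e\<^sub>j - e\<^sub>0\<close>,
  invariant. Hence the column sum splits off the characteristic polynomial as a root, whether or not
  the matrix is diagonalisable.\<close>

lemma similar_mat_constant_column_sums:
  fixes M :: "'a :: field mat"
  assumes M: "M \<in> carrier_mat (Suc m) (Suc m)"
    and column_sum: "\<And>j. j < Suc m \<Longrightarrow> (\<Sum>i<Suc m. M $$ (i, j)) = K"
  shows "similar_mat M (four_block_mat (mat 1 1 (\<lambda>_. K)) (0\<^sub>m 1 m)
    (mat m 1 (\<lambda>(i, j). M $$ (Suc i, 0))) (zero_sum_compression M))"
proof -
  define n where "n = Suc m"
  define T where "T = four_block_mat (mat 1 1 (\<lambda>_. K)) (0\<^sub>m 1 m)
    (mat m 1 (\<lambda>(i, j). M $$ (Suc i, 0))) (zero_sum_compression M)"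
  define P Q :: "'a mat" where "P = zero_sum_basis n" and "Q = zero_sum_coordinates n"
  have carrier: "M \<in> carrier_mat n n" "P \<in> carrier_mat n n" "Q \<in> carrier_mat n n"
      "T \<in> carrier_mat n n"
    using M by (auto simp: P_def Q_def T_def n_def zero_sum_compression_def)
  have T_index: "T $$ (i, j) = (if i = 0 then if j = 0 then K else 0
      else if j = 0 then M $$ (i, 0) else M $$ (i, j) - M $$ (i, 0))" if "i < n" "j < n" for i j
    using that M by (auto simp: T_def n_def zero_sum_compression_def)
  have PQ: "P * Q = 1\<^sub>m n"
    unfolding P_def Q_def n_def by (rule zero_sum_basis_mult_coordinates)
  have QM: "Q * M = T * Q"
  proof (rule eq_matI)
    fix i j assume "i < dim_row (T * Q)" "j < dim_col (T * Q)"
    hence ij: "i < n" "j < n" using carrier by auto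
    note if_mult = if_distrib[of "\<lambda>x. x * _"] if_distrib[of "\<lambda>x. _ * x"]
    have "(Q * M) $$ (i, j) = (\<Sum>l<n. Q $$ (i, l) * M $$ (l, j))"
      using ij carrier by (simp add: scalar_prod_def atLeast0LessThan)
    also have "\<dots> = (if i = 0 then K else M $$ (i, j))"
      using ij column_sum[of j] by (auto simp: Q_def zero_sum_coordinates_def n_def if_mult
          cong: if_cong simp del: sum.lessThan_Suc)
    also have "\<dots> = (\<Sum>l<n. T $$ (i, l) * Q $$ (l, j))"
      using ij by (cases j) (auto simp: Q_def zero_sum_coordinates_def T_index n_def
          sum.lessThan_Suc_shift if_mult cong: if_cong simp del: sum.lessThan_Suc)
    also have "\<dots> = (T * Q) $$ (i, j)"
      using ij carrier by (simp add: scalar_prod_def atLeast0LessThan)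
    finally show "(Q * M) $$ (i, j) = (T * Q) $$ (i, j)" .
  qed (use carrier in auto)
  have "M = P * Q * M" using carrier by (simp add: PQ)
  also have "\<dots> = P * T * Q"
    using carrier by (simp add: QM assoc_mult_mat[of _ n n _ n _ n])
  finally show ?thesis
    unfolding T_def[symmetric]
    using carrier PQ mat_mult_left_right_inverse[OF carrier(2,3) PQ] similar_matI[of M T P Q n]
    by blast
qed

lemma char_poly_constant_column_sums:
  fixes M :: "'a :: field mat"
  assumes M: "M \<in> carrier_mat (Suc m) (Suc m)"
    and column_sum: "\<And>j. j < Suc m \<Longrightarrow> (\<Sum>i<Suc m. M $$ (i, j)) = K"
  shows "char_poly M = [:- K, 1:] * char_poly (zero_sum_compression M)"
proof -
  define corner where "corner = mat 1 1 (\<lambda>_. K)"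
  define column where "column = mat m 1 (\<lambda>(i, j). M $$ (Suc i, 0))"
  define B where "B = zero_sum_compression M"
  define T where "T = four_block_mat corner (0\<^sub>m 1 m) column B"
  have carrier: "corner \<in> carrier_mat 1 1" "column \<in> carrier_mat m 1" "B \<in> carrier_mat m m"
    using zero_sum_compression_carrier[OF M] by (simp_all add: corner_def column_def B_def)
  hence T: "T \<in> carrier_mat (1 + m) (1 + m)" unfolding T_def by (intro four_block_carrier_mat)
  have "char_poly M = char_poly T"
    unfolding T_def corner_def column_def B_def
    by (rule char_poly_similar[OF similar_mat_constant_column_sums[OF M column_sum]])
  also have "\<dots> = char_poly T\<^sup>T"
    using char_poly_transpose_mat[OF T] by simp
  also have "T\<^sup>T = four_block_mat corner\<^sup>T column\<^sup>T (0\<^sub>m m 1) B\<^sup>T"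
    unfolding T_def using carrier by (subst transpose_four_block_mat) auto
  also have "char_poly \<dots> = char_poly corner\<^sup>T * char_poly B\<^sup>T"
    by (rule char_poly_four_block_zeros_col) (use carrier in auto)
  also have "char_poly corner\<^sup>T = [:- K, 1:]"
    by (simp add: corner_def char_poly_defs det_def sign_def)
  finally show ?thesis using carrier by (simp add: B_def)
qed

lemma zero_sum_compression_mult_vec_last:
  fixes M :: "'a :: comm_ring_1 mat"
  assumes M: "M \<in> carrier_mat (Suc m) (Suc m)" and v: "v \<in> carrier_vec (Suc m)"
    and zero_sum: "(\<Sum>i<Suc m. v $ i) = 0"
  shows "zero_sum_compression M *\<^sub>v vec_last v m = vec_last (M *\<^sub>v v) m"
proof (rule eq_vecI)
  fix i assume "i < dim_vec (vec_last (M *\<^sub>v v) m)"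
  hence i: "i < m" by simp
  have v_0: "v $ 0 = - (\<Sum>j<m. v $ Suc j)"
    using zero_sum unfolding sum.lessThan_Suc_shift by (rule eq_neg_iff_add_eq_0[THEN iffD2])
  have "(zero_sum_compression M *\<^sub>v vec_last v m) $ i =
      (\<Sum>j<m. (M $$ (Suc i, Suc j) - M $$ (Suc i, 0)) * v $ Suc j)"
    using i M v by (simp add: zero_sum_compression_def vec_last_def scalar_prod_def atLeast0LessThan)
  also have "\<dots> = M $$ (Suc i, 0) * v $ 0 + (\<Sum>j<m. M $$ (Suc i, Suc j) * v $ Suc j)"
    by (simp add: v_0 left_diff_distrib sum_subtractf sum_distrib_left)
  also have "\<dots> = vec_last (M *\<^sub>v v) m $ i"
    using i M v by (simp add: vec_last_def scalar_prod_def sum.atLeast0_lessThan_Suc_shift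
        del: sum.op_ivl_Suc flip: atLeast0LessThan)
  finally show "(zero_sum_compression M *\<^sub>v vec_last v m) $ i = vec_last (M *\<^sub>v v) m $ i" .
qed (use M in \<open>simp add: zero_sum_compression_def\<close>)

lemma zero_sum_vec_eq_iff:
  fixes v w :: "'a :: ab_group_add vec"
  assumes "v \<in> carrier_vec (Suc m)" "w \<in> carrier_vec (Suc m)"
    and "(\<Sum>i<Suc m. v $ i) = 0" "(\<Sum>i<Suc m. w $ i) = 0"
  shows "v = w \<longleftrightarrow> vec_last v m = vec_last w m"
proof
  assume last: "vec_last v m = vec_last w m"
  have tail: "v $ Suc i = w $ Suc i" if "i < m" for i
    using arg_cong[OF last, of "\<lambda>x. x $ i"] that assms(1,2) by (simp add: vec_last_def)
  hence "(\<Sum>i<m. v $ Suc i) = (\<Sum>i<m. w $ Suc i)" by (intro sum.cong) auto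
  hence "v $ 0 = w $ 0"
    using assms(3,4) unfolding sum.lessThan_Suc_shift by (simp add: add_eq_0_iff2)
  with tail show "v = w"
    using assms(1,2) by (intro eq_vecI) (auto simp: less_Suc_eq_0_disj)
qed simp

lemma sum_mult_mat_vec_constant_column_sums:
  fixes M :: "'a :: comm_ring_1 mat"
  assumes "M \<in> carrier_mat n n" "v \<in> carrier_vec n"
    and column_sum: "\<And>j. j < n \<Longrightarrow> (\<Sum>i<n. M $$ (i, j)) = K"
  shows "(\<Sum>i<n. (M *\<^sub>v v) $ i) = K * (\<Sum>i<n. v $ i)"
proof -
  have "(\<Sum>i<n. (M *\<^sub>v v) $ i) = (\<Sum>i<n. \<Sum>j<n. M $$ (i, j) * v $ j)"
    using assms(1,2) by (intro sum.cong) (auto simp: scalar_prod_def atLeast0LessThan)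
  also have "\<dots> = (\<Sum>j<n. (\<Sum>i<n. M $$ (i, j)) * v $ j)"
    by (subst sum.swap) (simp only: sum_distrib_right)
  also have "\<dots> = K * (\<Sum>j<n. v $ j)"
    unfolding sum_distrib_left by (intro sum.cong) (use column_sum in auto)
  finally show ?thesis .
qed

lemma eigenvector_zero_sum_compression_iff:
  fixes M :: "'a :: field mat"
  assumes M: "M \<in> carrier_mat (Suc m) (Suc m)"
    and column_sum: "\<And>j. j < Suc m \<Longrightarrow> (\<Sum>i<Suc m. M $$ (i, j)) = K"
    and v: "v \<in> carrier_vec (Suc m)" and zero_sum: "(\<Sum>i<Suc m. v $ i) = 0"
  shows "eigenvector (zero_sum_compression M) (vec_last v m) x \<longleftrightarrow> eigenvector M v x"
proof -
  have sum_Mv: "(\<Sum>i<Suc m. (M *\<^sub>v v) $ i) = 0"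
    using sum_mult_mat_vec_constant_column_sums[OF M v column_sum] zero_sum
    by (simp only: mult_zero_right)
  have "(\<Sum>i<Suc m. (x \<cdot>\<^sub>v v) $ i) = x * (\<Sum>i<Suc m. v $ i)"
    unfolding sum_distrib_left by (intro sum.cong) (use v in auto)
  hence sum_xv: "(\<Sum>i<Suc m. (x \<cdot>\<^sub>v v) $ i) = 0" by (simp only: zero_sum mult_zero_right)
  have "M *\<^sub>v v = x \<cdot>\<^sub>v v \<longleftrightarrow> vec_last (M *\<^sub>v v) m = vec_last (x \<cdot>\<^sub>v v) m"
    using M v by (intro zero_sum_vec_eq_iff[OF _ _ sum_Mv sum_xv]) auto
  moreover have "vec_last (x \<cdot>\<^sub>v v) m = x \<cdot>\<^sub>v vec_last v m"
    using v by (auto simp: vec_last_def)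
  moreover have "v = 0\<^sub>v (Suc m) \<longleftrightarrow> vec_last v m = vec_last (0\<^sub>v (Suc m)) m"
    using v zero_sum by (intro zero_sum_vec_eq_iff) auto
  moreover have "vec_last (0\<^sub>v (Suc m)) m = (0\<^sub>v m :: 'a vec)"
    by (auto simp: vec_last_def)
  ultimately show ?thesis
    using M v zero_sum_compression_mult_vec_last[OF M v zero_sum] zero_sum_compression_carrier[OF M]
    by (auto simp: eigenvector_def)
qed

lemma eigenvalue_zero_sum_compression_iff:
  fixes M :: "'a :: field mat"
  assumes M: "M \<in> carrier_mat (Suc m) (Suc m)"
    and column_sum: "\<And>j. j < Suc m \<Longrightarrow> (\<Sum>i<Suc m. M $$ (i, j)) = K"
  shows "eigenvalue (zero_sum_compression M) x \<longleftrightarrow>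
    (\<exists>v. eigenvector M v x \<and> (\<Sum>i<Suc m. v $ i) = 0)"
proof
  assume "eigenvalue (zero_sum_compression M) x"
  then obtain w where w: "eigenvector (zero_sum_compression M) w x" by (auto simp: eigenvalue_def)
  hence "w \<in> carrier_vec m" using M by (simp add: eigenvector_def zero_sum_compression_def)
  define v where "v = vec (Suc m) (\<lambda>i. case i of 0 \<Rightarrow> - (\<Sum>j<m. w $ j) | Suc j \<Rightarrow> w $ j)"
  have "vec_last v m = w" using \<open>w \<in> carrier_vec m\<close> by (auto simp: v_def vec_last_def)
  moreover have "(\<Sum>i<Suc m. v $ i) = 0"
    by (simp add: v_def sum.lessThan_Suc_shift del: sum.lessThan_Suc)
  ultimately show "\<exists>v. eigenvector M v x \<and> (\<Sum>i<Suc m. v $ i) = 0"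
    using w eigenvector_zero_sum_compression_iff[OF M column_sum, of v x] by (auto simp: v_def)
next
  assume "\<exists>v. eigenvector M v x \<and> (\<Sum>i<Suc m. v $ i) = 0"
  then obtain v where v: "eigenvector M v x" "(\<Sum>i<Suc m. v $ i) = 0" by blast
  hence "v \<in> carrier_vec (Suc m)" using M by (simp add: eigenvector_def)
  with v eigenvector_zero_sum_compression_iff[OF M column_sum]
  show "eigenvalue (zero_sum_compression M) x" by (auto simp: eigenvalue_def)
qed

section \<open>Eigenfunctions of graphs\<close>

definition eigenfunction ::
    "'a set \<Rightarrow> (('a \<Rightarrow> real) \<Rightarrow> 'a \<Rightarrow> real) \<Rightarrow> real \<Rightarrow> ('a \<Rightarrow> real) \<Rightarrow> bool" where
  "eigenfunction V T x f \<longleftrightarrow> (\<exists>u \<in> V. f u \<noteq> 0) \<and> (\<forall>u \<in> V. T f u = x * f u)"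

definition restricted_eigenfunction ::
    "'a set \<Rightarrow> (('a \<Rightarrow> real) \<Rightarrow> 'a \<Rightarrow> real) \<Rightarrow> real \<Rightarrow> ('a \<Rightarrow> real) \<Rightarrow> bool" where
  "restricted_eigenfunction V T x f \<longleftrightarrow> eigenfunction V T x f \<and> sum f V = 0"

definition restricted_eigenvalue :: "'a set \<Rightarrow> (('a \<Rightarrow> real) \<Rightarrow> 'a \<Rightarrow> real) \<Rightarrow> real \<Rightarrow> bool" where
  "restricted_eigenvalue V T x \<longleftrightarrow> (\<exists>f. restricted_eigenfunction V T x f)"

lemma restricted_eigenfunction_add:
  assumes "restricted_eigenfunction V S x f" "restricted_eigenfunction V T y f"
  shows "restricted_eigenfunction V (\<lambda>g u. S g u + T g u) (x + y) f"
  using assms by (simp add: restricted_eigenfunction_def eigenfunction_def distrib_right)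

lemma restricted_eigenfunction_summand:
  assumes "restricted_eigenfunction V (\<lambda>g u. S g u + T g u) z f" "restricted_eigenfunction V T y f"
  shows "restricted_eigenfunction V S (z - y) f"
  using assms by (fastforce simp: restricted_eigenfunction_def eigenfunction_def left_diff_distrib)

definition adjacency_operator :: "('a, 'b) pre_digraph \<Rightarrow> ('a \<Rightarrow> real) \<Rightarrow> 'a \<Rightarrow> real" where
  "adjacency_operator G f u = (\<Sum>v \<in> {v \<in> verts G. u \<rightarrow>\<^bsub>G\<^esub> v}. f v)"

definition vertex_vec :: "('a, 'b) pre_digraph \<Rightarrow> ('a \<Rightarrow> real) \<Rightarrow> real vec" where
  "vertex_vec G f = vec (card (verts G)) (\<lambda>i. f (from_nat_into (verts G) i))"

lemma vertex_vec_carrier [simp]: "vertex_vec G f \<in> carrier_vec (card (verts G))"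
  by (simp add: vertex_vec_def)

lemma adjacency_matrix_carrier [simp]:
  "adjacency_matrix G \<in> carrier_mat (card (verts G)) (card (verts G))"
  by (simp add: adjacency_matrix_def)

lemma sum_vertex_vec: "(\<Sum>i<card (verts G). vertex_vec G f $ i) = sum f (verts G)"
  by (simp add: vertex_vec_def sum.card_from_nat_into)

lemma algebraic_int_eigenvalue_of_int_mat:
  fixes x :: "'a :: field_char_0"
  assumes A: "A \<in> carrier_mat n n" and "eigenvalue (map_mat of_int A) x"
  shows "algebraic_int x"
proof (rule algebraic_int.intros)
  let ?q = "map_poly of_int (char_poly A) :: 'a poly"
  have "char_poly (map_mat of_int A) = ?q" by (rule of_int_hom.char_poly_hom[OF A])
  thus "poly ?q x = 0"
    using assms eigenvalue_root_char_poly[of "map_mat of_int A" n x] by simp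
  show "lead_coeff ?q = 1" using degree_monic_char_poly[OF A] by simp
  show "\<forall>i. coeff ?q i \<in> \<int>" by simp
qed

context fin_digraph
begin

lemma vertex_of_index: "i < card (verts G) \<Longrightarrow> from_nat_into (verts G) i \<in> verts G"
  by (rule from_nat_into) auto

lemma index_of_vertex:
  assumes "u \<in> verts G"
  obtains i where "i < card (verts G)" "from_nat_into (verts G) i = u"
proof -
  have "from_nat_into (verts G) ` {..<card (verts G)} = verts G"
    using bij_betw_from_nat_into_finite[OF finite_verts] by (rule bij_betw_imp_surj_on)
  with assms have "u \<in> from_nat_into (verts G) ` {..<card (verts G)}" by simp
  thus ?thesis using that by auto
qed

lemma vertex_vec_eq_iff: "vertex_vec G f = vertex_vec G g \<longleftrightarrow> (\<forall>u \<in> verts G. f u = g u)"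
proof
  assume eq: "vertex_vec G f = vertex_vec G g"
  show "\<forall>u \<in> verts G. f u = g u"
  proof
    fix u assume "u \<in> verts G"
    then obtain i where "i < card (verts G)" "from_nat_into (verts G) i = u"
      by (rule index_of_vertex)
    thus "f u = g u" using arg_cong[OF eq, of "\<lambda>v. v $ i"] by (simp add: vertex_vec_def)
  qed
qed (use vertex_of_index in \<open>auto simp: vertex_vec_def\<close>)

lemma vertex_vec_surj:
  assumes "v \<in> carrier_vec (card (verts G))"
  obtains f where "v = vertex_vec G f"
proof
  show "v = vertex_vec G (\<lambda>u. v $ to_nat_on (verts G) u)"
    using assms to_nat_on_finite[OF finite_verts]
    by (intro eq_vecI) (auto simp: vertex_vec_def bij_betw_def)
qed

lemma adjacency_matrix_mult_vertex_vec:
  "adjacency_matrix G *\<^sub>v vertex_vec G f = vertex_vec G (adjacency_operator G f)"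
proof (rule eq_vecI)
  fix i assume "i < dim_vec (vertex_vec G (adjacency_operator G f))"
  hence i: "i < card (verts G)" by (simp add: vertex_vec_def)
  let ?u = "from_nat_into (verts G) i"
  have "(adjacency_matrix G *\<^sub>v vertex_vec G f) $ i = (\<Sum>j<card (verts G).
      (\<lambda>v. if ?u \<rightarrow>\<^bsub>G\<^esub> v then f v else 0) (from_nat_into (verts G) j))"
    using i by (auto simp: adjacency_matrix_def vertex_vec_def scalar_prod_def atLeast0LessThan
        intro: sum.cong)
  also have "\<dots> = (\<Sum>v \<in> verts G. if ?u \<rightarrow>\<^bsub>G\<^esub> v then f v else 0)"
    by (rule sum.card_from_nat_into)
  also have "\<dots> = adjacency_operator G f ?u"
    unfolding adjacency_operator_def by (simp add: sum.inter_filter)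
  finally show "(adjacency_matrix G *\<^sub>v vertex_vec G f) $ i =
      vertex_vec G (adjacency_operator G f) $ i"
    using i by (simp add: vertex_vec_def)
qed (simp add: adjacency_matrix_def vertex_vec_def)

lemma eigenvector_vertex_vec_iff:
  "eigenvector (adjacency_matrix G) (vertex_vec G f) x \<longleftrightarrow>
    eigenfunction (verts G) (adjacency_operator G) x f"
proof -
  have "0\<^sub>v (card (verts G)) = vertex_vec G (\<lambda>_. 0)"
    "x \<cdot>\<^sub>v vertex_vec G f = vertex_vec G (\<lambda>u. x * f u)"
    by (auto simp: vertex_vec_def)
  thus ?thesis
    by (auto simp: eigenvector_def eigenfunction_def adjacency_matrix_mult_vertex_vec vertex_vec_eq_iff
        carrier_matD[OF adjacency_matrix_carrier])
qed

lemma eigenvector_adjacency_matrixE: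
  assumes "eigenvector (adjacency_matrix G) v x"
  obtains f where "v = vertex_vec G f"
proof (rule vertex_vec_surj)
  show "v \<in> carrier_vec (card (verts G))"
    using assms by (simp add: eigenvector_def carrier_matD[OF adjacency_matrix_carrier])
qed

lemma eigenvalue_adjacency_matrix_iff:
  "eigenvalue (adjacency_matrix G) x \<longleftrightarrow> (\<exists>f. eigenfunction (verts G) (adjacency_operator G) x f)"
proof
  assume "eigenvalue (adjacency_matrix G) x"
  then obtain v where v: "eigenvector (adjacency_matrix G) v x" by (auto simp: eigenvalue_def)
  then obtain f where "v = vertex_vec G f" by (rule eigenvector_adjacency_matrixE)
  with v show "\<exists>f. eigenfunction (verts G) (adjacency_operator G) x f"
    using eigenvector_vertex_vec_iff by blast
qed (auto simp: eigenvalue_def eigenvector_vertex_vec_iff[symmetric])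

lemma rational_eigenvalue_in_Ints:
  assumes "eigenfunction (verts G) (adjacency_operator G) x f" "x \<in> \<rat>"
  shows "x \<in> \<int>"
proof -
  let ?n = "card (verts G)"
  define A :: "int mat" where "A = mat ?n ?n
    (\<lambda>(i, j). if from_nat_into (verts G) i \<rightarrow>\<^bsub>G\<^esub> from_nat_into (verts G) j then 1 else 0)"
  have "adjacency_matrix G = map_mat of_int A"
    by (rule eq_matI) (auto simp: A_def adjacency_matrix_def)
  moreover have "eigenvalue (adjacency_matrix G) x"
    using assms(1) by (auto simp: eigenvalue_adjacency_matrix_iff)
  ultimately have "algebraic_int x"
    by (intro algebraic_int_eigenvalue_of_int_mat[of A ?n]) (auto simp: A_def)
  thus ?thesis using assms(2) by (rule rational_algebraic_int_is_int)
qed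

lemma max_common_neighbours_le:
  assumes "a \<in> verts G" "b \<in> verts G" "a \<noteq> b"
    and "\<And>u v. \<lbrakk>u \<in> verts G; v \<in> verts G; u \<noteq> v\<rbrakk> \<Longrightarrow> card (common_neighbours G u v) \<le> q"
  shows "max_common_neighbours G \<le> q"
proof -
  let ?S = "{card (common_neighbours G u v) | u v. u \<in> verts G \<and> v \<in> verts G \<and> u \<noteq> v}"
  have "finite ?S"
    by (rule finite_subset[of _ "case_prod (\<lambda>u v. card (common_neighbours G u v)) `
      (verts G \<times> verts G)"]) auto
  moreover have "?S \<noteq> {}" using assms(1-3) by blast
  ultimately show ?thesis
    unfolding max_common_neighbours_def using assms(4) by (subst Max_le_iff) auto
qed

end

lemma (in wf_digraph) common_neighbour_if_diameter_le_2:
  assumes "graph_diameter G \<le> 2" "u \<in> verts G" "v \<in> verts G" "u \<noteq> v" "\<not> u \<rightarrow>\<^bsub>G\<^esub> v"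
  obtains w where "u \<rightarrow>\<^bsub>G\<^esub> w" "w \<rightarrow>\<^bsub>G\<^esub> v"
proof -
  have "\<mu> (\<lambda>_. 1) u v \<le> graph_diameter G"
    unfolding graph_diameter_def by (rule SUP_upper2[of "(u, v)"]) (use assms(2,3) in auto)
  also have "\<dots> \<le> 2" by (rule assms(1))
  also have "(2 :: ereal) < 3" by simp
  finally obtain q where q: "awalk u q v" "ereal (awalk_cost (\<lambda>_. 1) q) < 3"
    unfolding \<mu>_def INF_less_iff by auto
  have "awalk_cost (\<lambda>_. 1) q = length q" by (induction q) auto
  with q(2) have "length q \<le> 2" by simp
  then consider "q = []" | a where "q = [a]" | a b where "q = [a, b]"
    by (cases q; cases "tl q") auto
  thus ?thesis
  proof cases
    case 1
    with q(1) assms(4) show ?thesis by (simp add: awalk_simps)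
  next
    case (2 a)
    with q(1) assms(5) show ?thesis by (auto simp: awalk_simps intro: in_arcs_imp_in_arcs_ends)
  next
    case (3 a b)
    with q(1) have "u \<rightarrow>\<^bsub>G\<^esub> head G a" "head G a \<rightarrow>\<^bsub>G\<^esub> v"
      by (auto simp: awalk_simps dest: in_arcs_imp_in_arcs_ends)
    thus ?thesis by (rule that)
  qed
qed

lemma (in digraph) out_degree_eq_card_neighbours:
  "out_degree G u = card {v \<in> verts G. u \<rightarrow>\<^bsub>G\<^esub> v}"
proof -
  have "bij_betw (head G) (out_arcs G u) {v \<in> verts G. u \<rightarrow>\<^bsub>G\<^esub> v}"
    unfolding bij_betw_def
    by (auto simp: inj_on_def out_arcs_def arcs_ends_def arc_to_ends_def image_def intro: no_multi_arcs)
  thus ?thesis by (simp add: out_degree_def bij_betw_same_card)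
qed

section \<open>Restricted eigenvalues of regular graphs\<close>

locale regular_graph = graph +
  fixes d :: nat
  assumes out_degree_eq: "u \<in> verts G \<Longrightarrow> out_degree G u = d"
begin

lemma card_neighbours: "u \<in> verts G \<Longrightarrow> card {v \<in> verts G. u \<rightarrow>\<^bsub>G\<^esub> v} = d"
  by (simp add: out_degree_eq flip: out_degree_eq_card_neighbours)

lemma dominates_sym: "u \<rightarrow>\<^bsub>G\<^esub> v \<longleftrightarrow> v \<rightarrow>\<^bsub>G\<^esub> u"
  using sym_arcs by (auto simp: symmetric_def sym_def)

lemma adjacency_operator_const: "u \<in> verts G \<Longrightarrow> adjacency_operator G (\<lambda>_. a) u = real d * a"
  by (simp add: adjacency_operator_def card_neighbours)

lemma sum_adjacency_operator: "sum (adjacency_operator G f) (verts G) = real d * sum f (verts G)"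
proof -
  have "sum (adjacency_operator G f) (verts G) = (\<Sum>v \<in> verts G. \<Sum>u \<in> {u \<in> verts G. v \<rightarrow>\<^bsub>G\<^esub> u}. f v)"
    unfolding adjacency_operator_def by (subst sum.swap_restrict) (simp_all add: dominates_sym)
  thus ?thesis by (simp add: card_neighbours sum_distrib_left)
qed

lemma restricted_eigenfunction_if_neq_degree:
  assumes "eigenfunction (verts G) (adjacency_operator G) x f" "x \<noteq> d"
  shows "restricted_eigenfunction (verts G) (adjacency_operator G) x f"
proof -
  have "real d * sum f (verts G) = x * sum f (verts G)"
    using assms(1) sum_adjacency_operator[of f] by (simp add: eigenfunction_def sum_distrib_left)
  thus ?thesis using assms by (auto simp: restricted_eigenfunction_def)
qed

lemma eigenfunction_const:
  assumes "verts G \<noteq> {}"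
  shows "eigenfunction (verts G) (adjacency_operator G) d (\<lambda>_. 1)"
  using assms by (auto simp: eigenfunction_def adjacency_operator_const)

lemma eigenvalue_smallest_eigenvalue:
  assumes "verts G \<noteq> {}"
  shows "eigenvalue (adjacency_matrix G) (smallest_eigenvalue G)"
proof -
  have "finite (spectrum (adjacency_matrix G))"
    using card_finite_spectrum(1)[OF adjacency_matrix_carrier] .
  moreover have "real d \<in> spectrum (adjacency_matrix G)"
    using eigenfunction_const[OF assms] by (auto simp: spectrum_def eigenvalue_adjacency_matrix_iff)
  ultimately have "Min (spectrum (adjacency_matrix G)) \<in> spectrum (adjacency_matrix G)"
    by (intro Min_in) auto
  thus ?thesis by (simp add: smallest_eigenvalue_def spectrum_def)
qed

lemma abs_eigenvalue_le_degree:
  assumes "eigenfunction (verts G) (adjacency_operator G) x f"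
  shows "\<bar>x\<bar> \<le> d"
proof -
  obtain w where "w \<in> verts G" "f w \<noteq> 0" using assms by (auto simp: eigenfunction_def)
  define b where "b = Max ((\<lambda>v. \<bar>f v\<bar>) ` verts G)"
  have "b \<in> (\<lambda>v. \<bar>f v\<bar>) ` verts G"
    unfolding b_def using \<open>w \<in> verts G\<close> by (intro Max_in) auto
  then obtain u where u: "u \<in> verts G" "b = \<bar>f u\<bar>" by auto
  have f_le: "\<bar>f v\<bar> \<le> b" if "v \<in> verts G" for v
    unfolding b_def using that by (intro Max_ge) auto
  hence "b > 0" using \<open>w \<in> verts G\<close> \<open>f w \<noteq> 0\<close> by (metis less_le_trans zero_less_abs_iff)
  have "\<bar>x\<bar> * b = \<bar>adjacency_operator G f u\<bar>"
    using assms u by (simp add: eigenfunction_def abs_mult)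
  also have "\<dots> \<le> (\<Sum>v \<in> {v \<in> verts G. u \<rightarrow>\<^bsub>G\<^esub> v}. \<bar>f v\<bar>)"
    unfolding adjacency_operator_def by (rule sum_abs)
  also have "\<dots> \<le> d * b"
    using sum_bounded_above[of "{v \<in> verts G. u \<rightarrow>\<^bsub>G\<^esub> v}" "\<lambda>v. \<bar>f v\<bar>" b] f_le
      card_neighbours[OF u(1)] by simp
  finally show ?thesis using \<open>b > 0\<close> by simp
qed

lemma column_sum_adjacency_matrix:
  assumes "j < card (verts G)"
  shows "(\<Sum>i<card (verts G). adjacency_matrix G $$ (i, j)) = d"
proof -
  have "(\<Sum>i<card (verts G). adjacency_matrix G $$ (i, j)) =
      (\<Sum>i<card (verts G). adjacency_matrix G $$ (j, i))"
    using assms by (intro sum.cong) (auto simp: adjacency_matrix_def dominates_sym)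
  also have "\<dots> = (adjacency_matrix G *\<^sub>v vertex_vec G (\<lambda>_. 1)) $ j"
    using assms carrier_matD[OF adjacency_matrix_carrier, of G]
    by (simp add: vertex_vec_def scalar_prod_def atLeast0LessThan)
  also have "\<dots> = adjacency_operator G (\<lambda>_. 1) (from_nat_into (verts G) j)"
    using assms by (simp only: adjacency_matrix_mult_vertex_vec) (simp add: vertex_vec_def)
  also have "\<dots> = d" using adjacency_operator_const[OF vertex_of_index[OF assms], of 1] by simp
  finally show ?thesis .
qed

lemma eigenvalue_zero_sum_compression_adjacency_matrix_iff:
  assumes "verts G \<noteq> {}"
  shows "eigenvalue (zero_sum_compression (adjacency_matrix G)) x \<longleftrightarrow>
    restricted_eigenvalue (verts G) (adjacency_operator G) x"
proof -
  obtain m where m: "card (verts G) = Suc m"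
    using assms by (metis card_0_eq finite_verts not0_implies_Suc)
  have "eigenvalue (zero_sum_compression (adjacency_matrix G)) x \<longleftrightarrow>
      (\<exists>v. eigenvector (adjacency_matrix G) v x \<and> (\<Sum>i<card (verts G). v $ i) = 0)"
    using eigenvalue_zero_sum_compression_iff[of "adjacency_matrix G" m d x]
      column_sum_adjacency_matrix adjacency_matrix_carrier[of G] unfolding m by blast
  also have "\<dots> \<longleftrightarrow> (\<exists>f. eigenvector (adjacency_matrix G) (vertex_vec G f) x \<and> sum f (verts G) = 0)"
  proof
    assume "\<exists>v. eigenvector (adjacency_matrix G) v x \<and> (\<Sum>i<card (verts G). v $ i) = 0"
    then obtain v where v: "eigenvector (adjacency_matrix G) v x" "(\<Sum>i<card (verts G). v $ i) = 0"
      by blast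
    obtain f where "v = vertex_vec G f" using v(1) by (rule eigenvector_adjacency_matrixE)
    with v show "\<exists>f. eigenvector (adjacency_matrix G) (vertex_vec G f) x \<and> sum f (verts G) = 0"
      by (intro exI[of _ f]) (simp add: sum_vertex_vec)
  next
    assume "\<exists>f. eigenvector (adjacency_matrix G) (vertex_vec G f) x \<and> sum f (verts G) = 0"
    thus "\<exists>v. eigenvector (adjacency_matrix G) v x \<and> (\<Sum>i<card (verts G). v $ i) = 0"
      unfolding sum_vertex_vec[symmetric] by blast
  qed
  finally show ?thesis
    by (simp add: restricted_eigenvalue_def restricted_eigenfunction_def eigenvector_vertex_vec_iff)
qed

lemma set_tl_adjacency_eigenvalues:
  assumes "verts G \<noteq> {}"
  shows "set (tl (adjacency_eigenvalues G)) =
    {x. restricted_eigenvalue (verts G) (adjacency_operator G) x}"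
proof -
  define B where "B = zero_sum_compression (adjacency_matrix G)"
  define R where "R = proots (char_poly B)"
  obtain m where m: "card (verts G) = Suc m"
    using assms by (metis card_0_eq finite_verts not0_implies_Suc)
  have carrier: "B \<in> carrier_mat m m"
    using zero_sum_compression_carrier[of "adjacency_matrix G" m] adjacency_matrix_carrier[of G]
    by (simp add: B_def m)
  hence "char_poly B \<noteq> 0" using degree_monic_char_poly[OF carrier] by auto
  hence "x \<in># proots (char_poly B) \<longleftrightarrow> eigenvalue B x" for x
    using eigenvalue_root_char_poly[OF carrier] by simp
  hence roots: "set_mset R = {x. restricted_eigenvalue (verts G) (adjacency_operator G) x}"
    unfolding R_def B_def eigenvalue_zero_sum_compression_adjacency_matrix_iff[OF assms] by blast
  have "char_poly (adjacency_matrix G) = [:- real d, 1:] * char_poly B"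
    unfolding B_def by (rule char_poly_constant_column_sums[of _ m])
      (use adjacency_matrix_carrier[of G] column_sum_adjacency_matrix m in simp_all)
  hence "proots (char_poly (adjacency_matrix G)) = add_mset (real d) R"
    using \<open>char_poly B \<noteq> 0\<close> by (simp add: R_def proots_mult del: mult_pCons_left)
  moreover have "x \<le> d" if "x \<in># R" for x
    using that abs_eigenvalue_le_degree
    unfolding roots restricted_eigenvalue_def restricted_eigenfunction_def by fastforce
  hence "sorted (sorted_list_of_multiset R @ [real d])" by (auto simp: sorted_append)
  hence "sorted_list_of_multiset (mset (sorted_list_of_multiset R @ [real d])) =
      sorted_list_of_multiset R @ [real d]"
    by (simp only: sorted_list_of_multiset_mset sorted_sort_id)
  ultimately show ?thesis by (simp add: adjacency_eigenvalues_def roots)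
qed

lemma zero_weight_spectral_radius_le:
  assumes "restricted_eigenvalue (verts G) (adjacency_operator G) y"
    and "\<And>x. restricted_eigenvalue (verts G) (adjacency_operator G) x \<Longrightarrow> \<bar>x\<bar> \<le> b"
  shows "zero_weight_spectral_radius G \<le> b"
proof -
  have "verts G \<noteq> {}"
    using assms(1) by (auto simp: restricted_eigenvalue_def restricted_eigenfunction_def eigenfunction_def)
  note tl = set_tl_adjacency_eigenvalues[OF this]
  have "tl (adjacency_eigenvalues G) \<noteq> []" using assms(1) tl by auto
  moreover have "\<bar>x\<bar> \<le> b" if "x \<in> set (tl (adjacency_eigenvalues G))" for x
    using that assms(2) unfolding tl by blast
  ultimately show ?thesis
    unfolding zero_weight_spectral_radius_def by (subst Max_le_iff) auto
qed

end

section \<open>Intersection numbers and adjacency operators of association schemes\<close>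

context association_scheme
begin

abbreviation p :: "nat \<Rightarrow> nat \<Rightarrow> nat \<Rightarrow> nat" where
  "p \<equiv> intersection_number V c"

abbreviation k :: "nat \<Rightarrow> nat" where
  "k \<equiv> constituent_degree V c"

abbreviation X :: "nat set \<Rightarrow> ('a, 'a \<times> 'a) pre_digraph" where
  "X I \<equiv> with_proj (color_graph V c I)"

lemma color_less: "\<lbrakk>u \<in> V; v \<in> V\<rbrakk> \<Longrightarrow> c u v < r"
  using surj_colors by fastforce

lemma color_occurs:
  assumes "t < r"
  obtains u v where "u \<in> V" "v \<in> V" "c u v = t"
proof -
  have "t \<in> case_prod c ` (V \<times> V)" using assms surj_colors by simp
  thus ?thesis using that by auto
qed

lemma card_intersection:
  assumes "i < r" "j < r" "u \<in> V" "v \<in> V"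
  shows "card {w \<in> V. c u w = i \<and> c w v = j} = p (c u v) i j"
proof -
  let ?Q = "\<lambda>q. \<forall>u' \<in> V. \<forall>v' \<in> V. c u' v' = c u v \<longrightarrow> card {w \<in> V. c u' w = i \<and> c w v' = j} = q"
  obtain q where "?Q q"
    using regularity[OF assms(1,2) color_less[OF assms(3,4)]] by blast
  hence "?Q (THE q. ?Q q)"
    by (rule theI) (use assms \<open>?Q q\<close> in blast)
  thus ?thesis using assms(3,4) unfolding intersection_number_def by blast
qed

lemma intersection_number_commute:
  assumes "i < r" "j < r" "t < r"
  shows "p t i j = p t j i"
proof -
  obtain u v where uv: "u \<in> V" "v \<in> V" "c u v = t" using color_occurs[OF assms(3)] .
  have "p t i j = card {w \<in> V. c u w = i \<and> c w v = j}"
    using card_intersection[of i j u v] assms uv by simp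
  also have "{w \<in> V. c u w = i \<and> c w v = j} = {w \<in> V. c v w = j \<and> c w u = i}"
    using uv symmetric_colors by auto
  also have "card \<dots> = p t j i"
    using card_intersection[of j i v u] assms uv symmetric_colors by simp
  finally show ?thesis .
qed

lemma card_color_neighbours:
  assumes "i < r" "u \<in> V"
  shows "card {w \<in> V. c u w = i} = k i"
proof -
  have "{w \<in> V. c u w = i} = {w \<in> V. c u w = i \<and> c w u = i}"
    using assms symmetric_colors by auto
  thus ?thesis
    using card_intersection[of i i u u] assms diagonal[of u u] by (simp add: constituent_degree_def)
qed

lemma constituent_degree_pos:
  assumes "i < r"
  shows "k i > 0"
proof -
  obtain u v where uv: "u \<in> V" "v \<in> V" "c u v = i" using color_occurs[OF assms] .
  hence "card {w \<in> V. c u w = i} > 0" using finite_vertices by (auto simp: card_gt_0_iff)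
  thus ?thesis using card_color_neighbours[OF assms uv(1)] by simp
qed

lemma sum_intersection_numbers:
  assumes "t < r" "i < r"
  shows "(\<Sum>j<r. p t i j) = k i"
proof -
  obtain u v where uv: "u \<in> V" "v \<in> V" "c u v = t" using color_occurs[OF assms(1)] .
  let ?S = "{w \<in> V. c u w = i}"
  have "(\<Sum>j<r. p t i j) = (\<Sum>j<r. card {w \<in> ?S. c w v = j})"
    using assms uv card_intersection[of i _ u v] by (simp add: conj_assoc)
  also have "\<dots> = (\<Sum>j<r. \<Sum>w \<in> {w \<in> ?S. c w v = j}. 1)" by simp
  also have "\<dots> = (\<Sum>w \<in> ?S. 1)"
    by (rule sum.group) (use finite_vertices uv color_less in auto)
  also have "\<dots> = k i" using card_color_neighbours assms uv by simp
  finally show ?thesis .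
qed

lemma intersection_number_le_degree:
  assumes "i < r" "j < r" "t < r"
  shows "p t i j \<le> k i"
proof -
  have "p t i j \<le> (\<Sum>j<r. p t i j)" using assms by (intro member_le_sum) auto
  thus ?thesis using sum_intersection_numbers assms by simp
qed

lemma intersection_number_0_right:
  assumes "t < r" "i < r"
  shows "p t i 0 = (if t = i then 1 else 0)"
proof -
  obtain u v where uv: "u \<in> V" "v \<in> V" "c u v = t" using color_occurs[OF assms(1)] .
  have "{w \<in> V. c u w = i \<and> c w v = 0} = (if t = i then {v} else {})"
    using uv diagonal by auto
  thus ?thesis using card_intersection[of i 0 u v] assms uv by (auto split: if_splits)
qed

lemma intersection_number_0_left:
  assumes "i < r" "j < r"
  shows "p 0 i j = (if i = j then k i else 0)"
proof (cases "i = j")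
  case False
  obtain u v where uv: "u \<in> V" "v \<in> V" "c u v = 0"
    using color_occurs[of 0] assms(1) by (metis gr_zeroI less_nat_zero_code)
  hence "{w \<in> V. c u w = i \<and> c w v = j} = {}"
    using False diagonal[of u v] symmetric_colors by auto
  hence "card {w \<in> V. c u w = i \<and> c w v = j} = 0" by (simp only: card.empty)
  thus ?thesis using card_intersection[of i j u v] assms uv False by simp
qed (simp add: constituent_degree_def)

lemma degree_mult_intersection_number:
  assumes "t < r" "i < r" "j < r"
  shows "k t * p t i j = k i * p i t j"
proof -
  obtain u v where "u \<in> V" "v \<in> V" "c u v = t" using color_occurs[OF assms(1)] .
  note u = \<open>u \<in> V\<close>
  let ?T = "{v \<in> V. c u v = t}" and ?I = "{w \<in> V. c u w = i}"
  have "k t * p t i j = (\<Sum>v \<in> ?T. card {w \<in> ?I. c w v = j})"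
    using card_color_neighbours[OF assms(1) u] card_intersection[OF assms(2,3) u]
    by (simp add: conj_assoc)
  also have "\<dots> = (\<Sum>v \<in> ?T. \<Sum>w \<in> {w \<in> ?I. c w v = j}. 1)" by simp
  also have "\<dots> = (\<Sum>w \<in> ?I. \<Sum>v \<in> {v \<in> ?T. c w v = j}. 1)"
    by (rule sum.swap_restrict) (simp_all add: finite_vertices)
  also have "\<dots> = (\<Sum>w \<in> ?I. card {v \<in> V. c u v = t \<and> c v w = j})"
  proof (rule sum.cong)
    fix w assume "w \<in> ?I"
    hence "{v \<in> ?T. c w v = j} = {v \<in> V. c u v = t \<and> c v w = j}" using symmetric_colors by auto
    thus "(\<Sum>v \<in> {v \<in> ?T. c w v = j}. 1) = card {v \<in> V. c u v = t \<and> c v w = j}" by simp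
  qed simp
  also have "\<dots> = k i * p i t j"
    using card_color_neighbours[OF assms(2) u] card_intersection[OF assms(1,3) u] by simp
  finally show ?thesis .
qed

lemma intersection_number_mono_degree:
  assumes "t < r" "i < r" "j < r" "k i \<le> k t"
  shows "p t i j \<le> p i t j"
proof -
  have "k t * p t i j \<le> k t * p i t j"
    unfolding degree_mult_intersection_number[OF assms(1-3)]
    using assms(4) by (rule mult_right_mono) simp
  thus ?thesis using constituent_degree_pos[OF assms(1)] by simp
qed

lemma degree_mult_intersection_number_le:
  assumes "t < r" "i < r" "j < r"
  shows "k t * p t i j \<le> k i * k j"
proof -
  have "p i t j \<le> k j"
    using intersection_number_le_degree[of j t i] intersection_number_commute[of t j i] assms by simp
  thus ?thesis by (simp add: degree_mult_intersection_number[OF assms])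
qed

text \<open>If \<open>v\<close> is a common \<open>i\<close>-neighbour of two vertices \<open>u\<close>, \<open>w\<close> in relation \<open>t\<close>, then the common
  \<open>i\<close>-neighbours of \<open>v, u\<close> and those of \<open>v, w\<close> are all among the \<open>k\<^sub>i\<close> neighbours of \<open>v\<close>.\<close>

lemma intersection_number_diagonal_le:
  assumes "i < r" "t < r" "p t i i > 0"
  shows "2 * p i i i \<le> k i + p t i i"
proof -
  obtain u w where uw: "u \<in> V" "w \<in> V" "c u w = t" using color_occurs[OF assms(2)] .
  have "card {v \<in> V. c u v = i \<and> c v w = i} \<noteq> 0"
    using card_intersection[of i i u w] assms uw by simp
  then obtain v where v: "v \<in> V" "c u v = i" "c v w = i"
    by (metis (mono_tags, lifting) card.empty equals0I mem_Collect_eq)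
  define S where "S x = {z \<in> V. c v z = i \<and> c z x = i}" for x
  have "finite (S x)" for x using finite_vertices by (simp add: S_def)
  hence "card (S u) + card (S w) = card (S u \<union> S w) + card (S u \<inter> S w)" by (intro card_Un_Int)
  moreover have "card (S u) = p i i i" "card (S w) = p i i i"
    using card_intersection[of i i v u] card_intersection[of i i v w] assms uw v symmetric_colors[of u v]
    by (simp_all add: S_def)
  moreover have "card (S u \<union> S w) \<le> card {z \<in> V. c v z = i}"
    by (rule card_mono) (auto simp: S_def finite_vertices)
  moreover have "card (S u \<inter> S w) \<le> card {z \<in> V. c u z = i \<and> c z w = i}"
    by (rule card_mono) (use uw symmetric_colors in \<open>auto simp: S_def finite_vertices\<close>)
  ultimately show ?thesis
    using card_color_neighbours[of i v] card_intersection[of i i u w] assms uw v by simp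
qed

definition adj :: "nat \<Rightarrow> ('a \<Rightarrow> real) \<Rightarrow> 'a \<Rightarrow> real" where
  "adj i f u = (\<Sum>v \<in> {v \<in> V. c u v = i}. f v)"

lemma adj_cong: "(\<And>v. v \<in> V \<Longrightarrow> f v = g v) \<Longrightarrow> adj i f u = adj i g u"
  unfolding adj_def by (rule sum.cong) auto

lemma adj_add: "adj i (\<lambda>v. f v + g v) u = adj i f u + adj i g u"
  by (simp add: adj_def sum.distrib)

lemma adj_diff: "adj i (\<lambda>v. f v - g v) u = adj i f u - adj i g u"
  by (simp add: adj_def sum_subtractf)

lemma adj_scale: "adj i (\<lambda>v. a * f v) u = a * adj i f u"
  by (simp add: adj_def sum_distrib_left)

lemma adj_0:
  assumes "u \<in> V"
  shows "adj 0 f u = f u"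
proof -
  have "{v \<in> V. c u v = 0} = {u}" using assms diagonal by auto
  thus ?thesis by (simp add: adj_def)
qed

lemma sum_adj_colors:
  assumes "u \<in> V"
  shows "(\<Sum>i<r. adj i f u) = sum f V"
  unfolding adj_def by (rule sum.group) (use assms finite_vertices color_less in auto)

lemma sum_adj_vertices:
  assumes "i < r"
  shows "sum (adj i f) V = real (k i) * sum f V"
proof -
  have "sum (adj i f) V = (\<Sum>v \<in> V. \<Sum>u \<in> {u \<in> V. c u v = i}. f v)"
    unfolding adj_def using finite_vertices by (intro sum.swap_restrict)
  also have "\<dots> = (\<Sum>v \<in> V. k i * f v)"
  proof (rule sum.cong)
    fix v assume "v \<in> V"
    hence "{u \<in> V. c u v = i} = {u \<in> V. c v u = i}" using symmetric_colors by auto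
    thus "(\<Sum>u \<in> {u \<in> V. c u v = i}. f v) = k i * f v"
      using card_color_neighbours[OF assms \<open>v \<in> V\<close>] by simp
  qed simp
  finally show ?thesis by (simp add: sum_distrib_left)
qed

lemma adj_adj:
  assumes "i < r" "j < r" "u \<in> V"
  shows "adj i (adj j f) u = (\<Sum>t<r. p t i j * adj t f u)"
proof -
  let ?I = "{w \<in> V. c u w = i}"
  have "adj i (adj j f) u = (\<Sum>v \<in> V. \<Sum>w \<in> {w \<in> ?I. c w v = j}. f v)"
    unfolding adj_def using finite_vertices by (intro sum.swap_restrict) auto
  also have "\<dots> = (\<Sum>v \<in> V. p (c u v) i j * f v)"
    using card_intersection[OF assms] by (intro sum.cong) (auto simp: conj_assoc)
  also have "\<dots> = (\<Sum>t<r. \<Sum>v \<in> {v \<in> V. c u v = t}. p (c u v) i j * f v)"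
    by (rule sum.group[symmetric]) (use assms finite_vertices color_less in auto)
  also have "\<dots> = (\<Sum>t<r. p t i j * adj t f u)"
    unfolding adj_def sum_distrib_left by (intro sum.cong) auto
  finally show ?thesis .
qed

lemma adj_commute:
  assumes "i < r" "j < r" "u \<in> V"
  shows "adj i (adj j f) u = adj j (adj i f) u"
  unfolding adj_adj[OF assms] adj_adj[OF assms(2,1,3)]
  by (rule sum.cong) (use intersection_number_commute[OF assms(1,2)] in auto)

section \<open>Color graphs\<close>

lemma pverts_color_graph [simp]: "pverts (color_graph V c I) = V"
  by (simp add: color_graph_def)

lemma parcs_color_graph [simp]:
  "(u, v) \<in> parcs (color_graph V c I) \<longleftrightarrow> u \<in> V \<and> v \<in> V \<and> u \<noteq> v \<and> c u v \<in> I"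
  by (simp add: color_graph_def)

lemma graph_color_graph: "graph (X I)"
proof -
  interpret pair_graph "color_graph V c I" by (rule pair_graph_color_graph)
  show ?thesis by unfold_locales
qed

lemma adjacency_operator_color_graph:
  assumes "I \<subseteq> {1..<r}" "u \<in> V"
  shows "adjacency_operator (X I) f u = (\<Sum>t \<in> I. adj t f u)"
proof -
  have "finite I" using assms(1) finite_subset by blast
  have neighbours: "{v \<in> verts (X I). u \<rightarrow>\<^bsub>X I\<^esub> v} = {v \<in> V. c u v \<in> I}"
    using assms diagonal[of u u] by auto
  have "adjacency_operator (X I) f u = (\<Sum>v \<in> {v \<in> V. c u v \<in> I}. f v)"
    unfolding adjacency_operator_def neighbours ..
  also have "\<dots> = (\<Sum>t \<in> I. \<Sum>v \<in> {v \<in> {v \<in> V. c u v \<in> I}. c u v = t}. f v)"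
    by (rule sum.group[symmetric]) (use finite_vertices \<open>finite I\<close> in auto)
  also have "\<dots> = (\<Sum>t \<in> I. adj t f u)"
    unfolding adj_def by (intro sum.cong) auto
  finally show ?thesis .
qed

lemma regular_graph_color_graph:
  assumes "I \<subseteq> {1..<r}"
  shows "regular_graph (X I) (\<Sum>t \<in> I. k t)"
proof -
  interpret graph "X I" by (rule graph_color_graph)
  show ?thesis
  proof
    fix u assume "u \<in> verts (X I)"
    hence "u \<in> V" by simp
    have "real (out_degree (X I) u) = adjacency_operator (X I) (\<lambda>_. 1) u"
      by (simp add: adjacency_operator_def out_degree_eq_card_neighbours del: with_proj_simps)
    also have "\<dots> = (\<Sum>t \<in> I. real (k t))"
      unfolding adjacency_operator_color_graph[OF assms \<open>u \<in> V\<close>]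
      using assms card_color_neighbours[OF _ \<open>u \<in> V\<close>] by (intro sum.cong) (auto simp: adj_def)
    finally show "out_degree (X I) u = (\<Sum>t \<in> I. k t)" by (simp flip: of_nat_sum)
  qed
qed

lemma restricted_eigenfunction_color_graph_iff:
  assumes "I \<subseteq> {1..<r}"
  shows "restricted_eigenfunction V (adjacency_operator (X I)) x f \<longleftrightarrow>
    restricted_eigenfunction V (\<lambda>g u. \<Sum>t \<in> I. adj t g u) x f"
  using adjacency_operator_color_graph[OF assms, of _ f]
  by (auto simp: restricted_eigenfunction_def eigenfunction_def)

lemma rational_adj_eigenvalue_in_Ints:
  assumes "restricted_eigenfunction V (adj i) x f" "i \<in> {1..<r}" "x \<in> \<rat>"
  shows "x \<in> \<int>"
proof -
  interpret graph "X {i}" by (rule graph_color_graph)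
  have "restricted_eigenfunction V (adjacency_operator (X {i})) x f"
    using assms(1,2) by (simp add: restricted_eigenfunction_color_graph_iff)
  thus ?thesis using rational_eigenvalue_in_Ints assms(3) by (auto simp: restricted_eigenfunction_def)
qed

lemma restricted_eigenvalue_smallest_eigenvalue:
  assumes "i \<in> {1..<r}" "smallest_eigenvalue (X {i}) < 0"
  shows "restricted_eigenvalue V (adj i) (smallest_eigenvalue (X {i}))"
proof -
  interpret regular_graph "X {i}" "k i" using regular_graph_color_graph[of "{i}"] assms(1) by simp
  let ?x = "smallest_eigenvalue (X {i})"
  have "V \<noteq> {}" using color_occurs[of i] assms(1) by auto
  then obtain f where "eigenfunction (verts (X {i})) (adjacency_operator (X {i})) ?x f"
    using eigenvalue_smallest_eigenvalue eigenvalue_adjacency_matrix_iff by auto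
  moreover have "?x \<noteq> k i" using assms(2) by linarith
  ultimately have "restricted_eigenfunction (verts (X {i})) (adjacency_operator (X {i})) ?x f"
    by (rule restricted_eigenfunction_if_neq_degree)
  thus ?thesis
    using assms(1) by (auto simp: restricted_eigenvalue_def restricted_eigenfunction_color_graph_iff)
qed

lemma card_common_neighbours_color_graph:
  assumes "u \<in> V" "v \<in> V" "I \<subseteq> {1..<r}"
  shows "card (common_neighbours (X I) u v) = (\<Sum>i \<in> I. \<Sum>j \<in> I. p (c u v) i j)"
proof -
  have "finite I" using assms(3) finite_subset by blast
  have "w \<in> common_neighbours (X I) u v \<longleftrightarrow> w \<in> V \<and> c u w \<in> I \<and> c w v \<in> I" for w
    using assms symmetric_colors[of v w] diagonal[of u w] diagonal[of v w]
    by (auto simp: common_neighbours_def)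
  hence "common_neighbours (X I) u v = (\<Union>(i, j) \<in> I \<times> I. {w \<in> V. c u w = i \<and> c w v = j})"
    by auto
  also have "card \<dots> = (\<Sum>(i, j) \<in> I \<times> I. card {w \<in> V. c u w = i \<and> c w v = j})"
    using \<open>finite I\<close> finite_vertices by (subst card_UN_disjoint) (auto intro: sum.cong)
  also have "\<dots> = (\<Sum>(i, j) \<in> I \<times> I. p (c u v) i j)"
    using assms by (auto intro!: sum.cong card_intersection)
  finally show ?thesis by (simp add: sum.cartesian_product)
qed

lemma max_common_neighbours_color_graph_le:
  assumes "I \<subseteq> {1..<r}" "r > 1"
    and "\<And>t. t \<in> {1..<r} \<Longrightarrow> (\<Sum>i \<in> I. \<Sum>j \<in> I. p t i j) \<le> q"
  shows "max_common_neighbours (X I) \<le> q"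
proof -
  interpret graph "X I" by (rule graph_color_graph)
  obtain a b where ab: "a \<in> V" "b \<in> V" "c a b = 1" using color_occurs[OF assms(2)] .
  show ?thesis
  proof (rule max_common_neighbours_le)
    show "a \<in> verts (X I)" "b \<in> verts (X I)" "a \<noteq> b" using ab diagonal[of a b] by auto
    fix u v assume "u \<in> verts (X I)" "v \<in> verts (X I)" "u \<noteq> v"
    hence uv: "u \<in> V" "v \<in> V" "c u v \<in> {1..<r}" using color_less[of u v] diagonal[of u v] by auto
    show "card (common_neighbours (X I) u v) \<le> q"
      unfolding card_common_neighbours_color_graph[OF uv(1,2) assms(1)] using uv(3) by (rule assms(3))
  qed
qed

lemma strongly_regular_constituentE:
  assumes "strongly_regular (X {s})" "s \<in> {1..<r}"
  obtains m where "\<And>t. \<lbrakk>t < r; t \<noteq> 0; t \<noteq> s\<rbrakk> \<Longrightarrow> p t s s = m"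
proof -
  obtain m where m: "\<And>u v. \<lbrakk>u \<in> V; v \<in> V; u \<noteq> v; c u v \<noteq> s\<rbrakk> \<Longrightarrow>
      card (common_neighbours (X {s}) u v) = m"
    using assms(1) unfolding strongly_regular_def by auto
  show ?thesis
  proof
    fix t assume t: "t < r" "t \<noteq> 0" "t \<noteq> s"
    then obtain u v where uv: "u \<in> V" "v \<in> V" "c u v = t" using color_occurs by blast
    hence "u \<noteq> v" using t diagonal[of u v] by auto
    with m[OF uv(1,2)] uv t assms(2) card_common_neighbours_color_graph[OF uv(1,2), of "{s}"]
    show "p t s s = m" by simp
  qed
qed

lemma intersection_number_pos_if_diameter_le_2:
  assumes "graph_diameter (X {i}) \<le> 2" "t < r" "i < r" "t \<noteq> 0" "t \<noteq> i"
  shows "p t i i > 0"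
proof -
  interpret graph "X {i}" by (rule graph_color_graph)
  obtain u v where uv: "u \<in> V" "v \<in> V" "c u v = t" using color_occurs[OF assms(2)] .
  hence "u \<noteq> v" "\<not> u \<rightarrow>\<^bsub>X {i}\<^esub> v" using assms(4,5) diagonal[of u v] by auto
  then obtain w where "u \<rightarrow>\<^bsub>X {i}\<^esub> w" "w \<rightarrow>\<^bsub>X {i}\<^esub> v"
    using common_neighbour_if_diameter_le_2[OF assms(1)] uv by auto
  hence "w \<in> {w \<in> V. c u w = i \<and> c w v = i}" by simp
  hence "card {w \<in> V. c u w = i \<and> c w v = i} > 0"
    using finite_vertices by (auto simp: card_gt_0_iff)
  thus ?thesis using card_intersection[of i i u v] assms uv by simp
qed

end

section \<open>Strongly regular constituents\<close>

locale strongly_regular_color = association_scheme +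
  fixes s mu :: nat and \<tau> :: real
  assumes color: "s \<in> {1..<r}"
    and intersection_number_eq_mu: "\<lbrakk>t < r; t \<noteq> 0; t \<noteq> s\<rbrakk> \<Longrightarrow> p t s s = mu"
    and restricted_eigenvalue_tau: "restricted_eigenvalue V (adj s) \<tau>"
begin

text \<open>The second root of the quadratic in \<open>tau_square\<close>.\<close>

definition \<theta> :: real where "\<theta> = real (p s s s) - mu - \<tau>"

lemma adj_adj_strongly_regular:
  assumes "u \<in> V" "sum f V = 0"
  shows "adj s (adj s f) u = (real (k s) - mu) * f u + (real (p s s s) - mu) * adj s f u"
proof -
  have "adj s (adj s f) u = (\<Sum>t<r. p t s s * adj t f u) - mu * (\<Sum>t<r. adj t f u)"
    using adj_adj[of s s u f] color assms sum_adj_colors[of u f] by simp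
  also have "\<dots> = (\<Sum>t<r. (real (p t s s) - mu) * adj t f u)"
    by (simp add: sum_distrib_left left_diff_distrib sum_subtractf)
  also have "\<dots> = (\<Sum>t \<in> {0, s}. (real (p t s s) - mu) * adj t f u)"
    by (rule sum.mono_neutral_right) (use color intersection_number_eq_mu in auto)
  finally show ?thesis
    using color adj_0[OF assms(1), of f] intersection_number_0_left[of s s] by simp
qed

lemma tau_square: "\<tau> * \<tau> = (real (k s) - mu) + (real (p s s s) - mu) * \<tau>"
proof -
  obtain f u where f: "sum f V = 0" "u \<in> V" "f u \<noteq> 0" "\<And>v. v \<in> V \<Longrightarrow> adj s f v = \<tau> * f v"
    using restricted_eigenvalue_tau
    by (auto simp: restricted_eigenvalue_def restricted_eigenfunction_def eigenfunction_def)
  have "\<tau> * \<tau> * f u = adj s (\<lambda>v. \<tau> * f v) u" using f by (simp add: adj_scale)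
  also have "\<dots> = adj s (adj s f) u" by (rule adj_cong) (use f in auto)
  also have "\<dots> = ((real (k s) - mu) + (real (p s s s) - mu) * \<tau>) * f u"
    using adj_adj_strongly_regular[OF f(2,1)] f by (simp add: algebra_simps)
  finally show ?thesis using f(3) by simp
qed

lemma restricted_eigenfunction_theta:
  assumes "sum f V = 0" "w \<in> V" "adj s f w \<noteq> \<tau> * f w"
  shows "restricted_eigenfunction V (adj s) \<theta> (\<lambda>v. adj s f v - \<tau> * f v)"
proof -
  have "adj s (\<lambda>v. adj s f v - \<tau> * f v) u = \<theta> * (adj s f u - \<tau> * f u)" if "u \<in> V" for u
  proof -
    have "adj s (\<lambda>v. adj s f v - \<tau> * f v) u = (real (k s) - mu) * f u + \<theta> * adj s f u"
      by (simp add: adj_diff adj_scale adj_adj_strongly_regular[OF that assms(1)] \<theta>_def algebra_simps)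
    also have "real (k s) - mu = - \<theta> * \<tau>"
      using tau_square by (simp add: \<theta>_def algebra_simps)
    finally show ?thesis by (simp add: algebra_simps)
  qed
  moreover have "(\<Sum>v \<in> V. adj s f v - \<tau> * f v) = 0"
    using sum_adj_vertices[of s f] color assms(1) by (simp add: sum_subtractf flip: sum_distrib_left)
  moreover have "\<exists>u \<in> V. adj s f u - \<tau> * f u \<noteq> 0" using assms(2,3) by auto
  ultimately show ?thesis by (simp add: restricted_eigenfunction_def eigenfunction_def)
qed

lemma restricted_eigenvalue_theta:
  assumes "t \<in> {1..<r}" "t \<noteq> s" "\<tau> \<noteq> 0"
  shows "restricted_eigenvalue V (adj s) \<theta>"
proof -
  obtain u v where uv: "u \<in> V" "v \<in> V" "c u v = t" using color_occurs[of t] assms(1) by auto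
  hence "u \<noteq> v" using diagonal[of u v] assms(1) by auto
  define e where "e w = (if w = u then 1 else 0) - (if w = v then 1 else (0 :: real))" for w
  have "sum e V = 0" unfolding e_def sum_subtractf using uv finite_vertices by simp
  have "e w = 0" if "c u w = s" for w
    using that color assms(2) uv diagonal[of u u] by (auto simp: e_def)
  hence "adj s e u = 0" unfolding adj_def by (intro sum.neutral) auto
  hence "adj s e u \<noteq> \<tau> * e u" using assms(3) \<open>u \<noteq> v\<close> by (simp add: e_def)
  with \<open>sum e V = 0\<close> uv(1) show ?thesis
    unfolding restricted_eigenvalue_def by (blast intro: restricted_eigenfunction_theta)
qed

lemma restricted_eigenfunction_sum_split:
  assumes i: "i < r" and f: "restricted_eigenfunction V (\<lambda>g u. adj i g u + adj s g u) \<xi> f"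
  obtains y g where "restricted_eigenfunction V (adj i) (\<xi> - y) g"
    "restricted_eigenfunction V (adj s) y g" "y \<in> {\<tau>, \<theta>}"
proof (cases "\<exists>w \<in> V. adj s f w \<noteq> \<tau> * f w")
  case True
  define g where "g v = adj s f v - \<tau> * f v" for v
  have eigen: "adj i f u + adj s f u = \<xi> * f u" if "u \<in> V" for u
    using f that by (simp add: restricted_eigenfunction_def eigenfunction_def)
  have "sum f V = 0" using f by (simp add: restricted_eigenfunction_def)
  hence g: "restricted_eigenfunction V (adj s) \<theta> g"
    using True restricted_eigenfunction_theta unfolding g_def[abs_def] by blast
  have "adj i g u + adj s g u = \<xi> * g u" if "u \<in> V" for u
  proof -
    have "adj i g u + adj s g u =
        (adj i (adj s f) u + adj s (adj s f) u) - \<tau> * (adj i f u + adj s f u)"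
      by (simp add: g_def[abs_def] adj_diff adj_scale algebra_simps)
    also have "adj i (adj s f) u + adj s (adj s f) u = adj s (\<lambda>v. adj i f v + adj s f v) u"
      using adj_commute[of i s u f] i color \<open>u \<in> V\<close> by (simp add: adj_add)
    also have "\<dots> = adj s (\<lambda>v. \<xi> * f v) u" by (rule adj_cong) (rule eigen)
    also have "\<dots> - \<tau> * (adj i f u + adj s f u) = \<xi> * g u"
      by (simp add: eigen[OF \<open>u \<in> V\<close>] adj_scale g_def algebra_simps)
    finally show ?thesis .
  qed
  hence "restricted_eigenfunction V (\<lambda>g u. adj i g u + adj s g u) \<xi> g"
    using g by (simp add: restricted_eigenfunction_def eigenfunction_def)
  from restricted_eigenfunction_summand[OF this g] g show ?thesis by (rule that) simp
next
  case False
  hence "restricted_eigenfunction V (adj s) \<tau> f"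
    using f by (simp add: restricted_eigenfunction_def eigenfunction_def)
  with restricted_eigenfunction_summand[OF f this] show ?thesis by (rule that) simp
qed

end

section \<open>Joint eigenvalues in rank 4\<close>

lemma sum_lessThan_4: "(\<Sum>t<4. g t) = g 0 + g 1 + g 2 + g (3 :: nat)"
  for g :: "nat \<Rightarrow> 'b :: comm_monoid_add"
  by (simp add: eval_nat_numeral)

locale rank4_scheme = association_scheme V c 4 for V :: "'a set" and c
begin

lemma adj_adj_zero_sum:
  assumes "i < 4" "j < 4" "u \<in> V" "sum f V = 0"
  shows "adj i (adj j f) u = (if i = j then real (k i) else 0) * f u + p 1 i j * adj 1 f u
    + p 2 i j * adj 2 f u - p 3 i j * (f u + adj 1 f u + adj 2 f u)"
proof -
  have "f u + adj 1 f u + adj 2 f u + adj 3 f u = 0"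
    using sum_adj_colors[OF assms(3), of f] assms(4) adj_0[OF assms(3), of f]
    unfolding sum_lessThan_4 by simp
  hence "adj 3 f u = - (f u + adj 1 f u + adj 2 f u)" by linarith
  thus ?thesis
    using intersection_number_0_left[OF assms(1,2)] adj_0[OF assms(3), of f]
    unfolding adj_adj[OF assms(1-3)] sum_lessThan_4 by (simp add: right_diff_distrib distrib_left)
qed

lemma restricted_eigenfunction_X_12_iff:
  "restricted_eigenfunction V (adjacency_operator (X {1, 2})) \<xi> f \<longleftrightarrow>
    restricted_eigenfunction V (\<lambda>g u. adj 1 g u + adj 2 g u) \<xi> f"
  by (simp add: restricted_eigenfunction_color_graph_iff)

definition joint_eigenvalues :: "real \<Rightarrow> real \<Rightarrow> bool" where
  "joint_eigenvalues x y \<longleftrightarrow>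
     (\<exists>f. restricted_eigenfunction V (adj 1) x f \<and> restricted_eigenfunction V (adj 2) y f)"

lemma joint_eigenvalues_square:
  fixes x y :: real
  assumes "joint_eigenvalues x y"
  shows "x * x = k 1 + p 1 1 1 * x + p 2 1 1 * y - p 3 1 1 * (1 + x + y)"
proof -
  obtain f u where f: "sum f V = 0" "u \<in> V" "f u \<noteq> 0"
    "\<And>v. v \<in> V \<Longrightarrow> adj 1 f v = x * f v" "\<And>v. v \<in> V \<Longrightarrow> adj 2 f v = y * f v"
    using assms by (auto simp: joint_eigenvalues_def restricted_eigenfunction_def eigenfunction_def)
  have "x * x * f u = adj 1 (\<lambda>v. x * f v) u" using f by (simp add: adj_scale)
  also have "\<dots> = adj 1 (adj 1 f) u" by (rule adj_cong) (use f in auto)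
  also have "\<dots> = (k 1 + p 1 1 1 * x + p 2 1 1 * y - p 3 1 1 * (1 + x + y)) * f u"
    using adj_adj_zero_sum[of 1 1 u f] f by (simp add: algebra_simps)
  finally show ?thesis using f(3) by simp
qed

lemma adj_1_of_adj_2_eigenfunction:
  fixes y :: real and f :: "'a \<Rightarrow> real"
  assumes "restricted_eigenfunction V (adj 2) y f" "u \<in> V"
  shows "(y - p 1 1 2 + p 3 1 2) * adj 1 f u = (p 2 1 2 * y - p 3 1 2 * (1 + y)) * f u"
proof -
  have f: "sum f V = 0" "\<And>v. v \<in> V \<Longrightarrow> adj 2 f v = y * f v"
    using assms(1) by (simp_all add: restricted_eigenfunction_def eigenfunction_def)
  have "y * adj 1 f u = adj 1 (\<lambda>v. y * f v) u" by (simp add: adj_scale)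
  also have "\<dots> = adj 1 (adj 2 f) u" by (rule adj_cong) (use f in auto)
  finally show ?thesis
    using adj_adj_zero_sum[of 1 2 u f] f assms(2) by (simp add: algebra_simps)
qed

lemma joint_eigenvalues_mult:
  fixes x y :: real
  assumes "joint_eigenvalues x y"
  shows "(y - p 1 1 2 + p 3 1 2) * x = p 2 1 2 * y - p 3 1 2 * (1 + y)"
proof -
  obtain f u where "restricted_eigenfunction V (adj 2) y f" "u \<in> V" "f u \<noteq> 0" "adj 1 f u = x * f u"
    using assms by (auto simp: joint_eigenvalues_def restricted_eigenfunction_def eigenfunction_def)
  thus ?thesis using adj_1_of_adj_2_eigenfunction[of y f u] by simp
qed

lemma restricted_eigenfunction_adj_1:
  fixes x y :: real and f :: "'a \<Rightarrow> real"
  assumes f: "restricted_eigenfunction V (adj 2) y f" and nonzero: "y - p 1 1 2 + p 3 1 2 \<noteq> 0"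
    and x: "(y - p 1 1 2 + p 3 1 2) * x = p 2 1 2 * y - p 3 1 2 * (1 + y)"
  shows "restricted_eigenfunction V (adj 1) x f"
proof -
  have "adj 1 f u = x * f u" if "u \<in> V" for u
    using adj_1_of_adj_2_eigenfunction[OF f that] nonzero unfolding x[symmetric] by simp
  thus ?thesis using f by (simp add: restricted_eigenfunction_def eigenfunction_def)
qed

end

locale rank4_srg_scheme = rank4_scheme + strongly_regular_color V c 4 2 mu "-2" for mu
begin

lemma p_122: "p 1 2 2 = mu" and p_322: "p 3 2 2 = mu"
  by (simp_all add: intersection_number_eq_mu)

lemma two_mult_p_222: "2 * real (p 2 2 2) = real (k 2) + mu - 4"
  using tau_square by (simp add: algebra_simps)

lemma theta_eq: "\<theta> = (real (k 2) - mu) / 2"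
  using two_mult_p_222 by (simp add: \<theta>_def)

lemma k_3_mult_p_312: "real (k 3) * p 3 1 2 = real (k 1) * (real (k 2) - p 1 1 2 - mu)"
proof -
  have "p 1 2 0 + p 1 2 1 + p 1 2 2 + p 1 2 3 = k 2"
    using sum_intersection_numbers[of 1 2] unfolding sum_lessThan_4 by simp
  moreover have "p 1 2 0 = 0" "p 1 2 1 = p 1 1 2" "p 1 2 3 = p 1 3 2"
    using intersection_number_0_right[of 1 2] by (simp_all add: intersection_number_commute)
  ultimately have "real (p 1 3 2) = real (k 2) - p 1 1 2 - mu" using p_122 by simp
  moreover have "real (k 3 * p 3 1 2) = real (k 1 * p 1 3 2)"
    using degree_mult_intersection_number[of 3 1 2] by simp
  ultimately show ?thesis by simp
qed

lemma k_3_mult_p_212: "real (k 3) * p 2 1 2 = real (k 1) * (real (k 2) - 1 - p 2 1 2 - p 2 2 2)"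
proof -
  have "k 2 * (k 3 * p 2 1 2) = k 3 * (k 1 * p 1 2 2)"
    using degree_mult_intersection_number[of 2 1 2] by (simp add: mult_ac)
  also have "\<dots> = k 1 * (k 3 * p 3 2 2)" unfolding p_122 p_322 by simp
  also have "\<dots> = k 2 * (k 1 * p 2 3 2)"
    using degree_mult_intersection_number[of 3 2 2] by (simp add: mult_ac)
  finally have "k 3 * p 2 1 2 = k 1 * p 2 3 2" using constituent_degree_pos[of 2] by simp
  hence "real (k 3) * p 2 1 2 = real (k 1) * p 2 3 2" by (simp flip: of_nat_mult)
  moreover have "p 2 2 0 + p 2 2 1 + p 2 2 2 + p 2 2 3 = k 2"
    using sum_intersection_numbers[of 2 2] unfolding sum_lessThan_4 by simp
  moreover have "p 2 2 0 = 1" "p 2 2 1 = p 2 1 2" "p 2 2 3 = p 2 3 2"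
    using intersection_number_0_right[of 2 2] by (simp_all add: intersection_number_commute)
  ultimately have "real (p 2 3 2) = real (k 2) - 1 - p 2 1 2 - p 2 2 2" by simp
  with \<open>real (k 3) * p 2 1 2 = real (k 1) * p 2 3 2\<close> show ?thesis by simp
qed

lemma k_3_mult_two_p_212_minus_p_312:
  "real (k 3) * (2 * real (p 2 1 2) - p 3 1 2) =
    real (k 1) * (2 + real (p 1 1 2) - 2 * real (p 2 1 2))"
proof -
  have "real (k 3) * (2 * real (p 2 1 2) - p 3 1 2) =
      2 * (real (k 3) * p 2 1 2) - real (k 3) * p 3 1 2"
    by (simp add: algebra_simps)
  also have "\<dots> =
      real (k 1) * (real (k 2) - 2 * real (p 2 2 2) + mu - 2 - 2 * real (p 2 1 2) + p 1 1 2)"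
    unfolding k_3_mult_p_212 k_3_mult_p_312 by (simp add: algebra_simps)
  finally show ?thesis using two_mult_p_222 by simp
qed

lemma restricted_eigenvalue_adj_1:
  assumes "2 + real (p 1 1 2) - p 3 1 2 \<noteq> 0"
  shows "restricted_eigenvalue V (adj 1)
    ((2 * real (p 2 1 2) - p 3 1 2) / (2 + real (p 1 1 2) - p 3 1 2))"
proof -
  define a b where "a = 2 * real (p 2 1 2) - p 3 1 2" and "b = 2 + real (p 1 1 2) - p 3 1 2"
  obtain f where f: "restricted_eigenfunction V (adj 2) (- 2) f"
    using restricted_eigenvalue_tau by (auto simp: restricted_eigenvalue_def)
  have b: "- 2 - real (p 1 1 2) + real (p 3 1 2) = - b" "b \<noteq> 0" using assms by (simp_all add: b_def)
  have "restricted_eigenfunction V (adj 1) (a / b) f"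
  proof (rule restricted_eigenfunction_adj_1[OF f])
    show "- 2 - real (p 1 1 2) + real (p 3 1 2) \<noteq> 0" using b by simp
    show "(- 2 - real (p 1 1 2) + real (p 3 1 2)) * (a / b) =
        real (p 2 1 2) * - 2 - real (p 3 1 2) * (1 + - 2)"
      unfolding b(1) using b(2) by (simp add: a_def)
  qed
  thus ?thesis by (auto simp: restricted_eigenvalue_def a_def b_def)
qed

text \<open>If the bound failed, the rational eigenvalue of \<open>X\<^sub>1\<close> above would lie strictly between 0
  and 1, although it is an algebraic integer.\<close>

lemma p_112_le: "p 1 1 2 \<le> 2 * p 2 1 2"
proof (rule ccontr)
  assume "\<not> p 1 1 2 \<le> 2 * p 2 1 2"
  hence p_112_gt: "2 * real (p 2 1 2) < p 1 1 2" by linarith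
  define a b where "a = 2 * real (p 2 1 2) - p 3 1 2" and "b = 2 + real (p 1 1 2) - p 3 1 2"
  have "real (k 3) * a > 0"
    unfolding a_def k_3_mult_two_p_212_minus_p_312 using p_112_gt constituent_degree_pos[of 1] by simp
  hence "0 < a" by (simp add: zero_less_mult_iff)
  moreover have "a < b" using p_112_gt by (simp add: a_def b_def)
  ultimately have "0 < a / b" "a / b < 1" "b \<noteq> 0" by simp_all
  have "restricted_eigenvalue V (adj 1) (a / b)"
    using restricted_eigenvalue_adj_1 \<open>b \<noteq> 0\<close> unfolding a_def b_def by blast
  moreover have "a / b \<in> \<rat>" by (simp add: a_def b_def)
  ultimately have "a / b \<in> \<int>"
    unfolding restricted_eigenvalue_def using rational_adj_eigenvalue_in_Ints[of 1] by auto
  then obtain z where "a / b = of_int z" by (elim Ints_cases)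
  with \<open>0 < a / b\<close> \<open>a / b < 1\<close> show False by simp
qed

end

section \<open>Bounds when the third degree dominates\<close>

locale dominated_rank4_srg_scheme = rank4_srg_scheme +
  assumes p_311_pos: "p 3 1 1 > 0" and mu_pos: "mu > 0"
    and k_1_le_k_2: "k 1 \<le> k 2"
    and k_3_large: "100000 * k 2 \<le> k 3"
begin

lemma p_3_small:
  assumes "i \<in> {1, 2}" "j \<in> {1, 2}"
  shows "100000 * p 3 i j \<le> k 2"
proof -
  have "k i \<le> k 2" "k j \<le> k 2" using assms k_1_le_k_2 by auto
  have "k 2 * (100000 * p 3 i j) = 100000 * k 2 * p 3 i j" by simp
  also have "\<dots> \<le> k 3 * p 3 i j" using k_3_large by (rule mult_le_mono1)
  also have "\<dots> \<le> k i * k j" using assms by (intro degree_mult_intersection_number_le) auto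
  also have "\<dots> \<le> k 2 * k 2" using \<open>k i \<le> k 2\<close> \<open>k j \<le> k 2\<close> by (rule mult_le_mono)
  finally show ?thesis using constituent_degree_pos[of 2] by simp
qed

lemma mu_small: "100000 * mu \<le> k 2"
  using p_3_small[of 2 2] by (simp add: p_322)

lemma k_2_large: "100000 \<le> k 2"
  using mu_small mu_pos by linarith

lemma p_212_le_mu: "p 2 1 2 \<le> mu"
  using intersection_number_mono_degree[of 2 1 2] k_1_le_k_2 p_122 by simp

lemma p_112_le_mu: "p 1 1 2 \<le> 2 * mu"
  using p_112_le p_212_le_mu by linarith

lemma p_211_le_mu: "p 2 1 1 \<le> 2 * mu"
  using intersection_number_mono_degree[of 2 1 1] k_1_le_k_2 p_112_le_mu
    intersection_number_commute[of 2 1 1] by simp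

lemma p_111_le: "2 * p 1 1 1 \<le> k 2 + p 3 1 1"
  using intersection_number_diagonal_le[of 1 3] p_311_pos k_1_le_k_2 by simp

lemma sum_intersection_numbers_12_le:
  assumes "t \<in> {1..<4}"
  shows "100 * (\<Sum>i \<in> {1, 2}. \<Sum>j \<in> {1, 2}. p t i j) \<le> 51 * k 2"
proof -
  have "p t 2 1 = p t 1 2" using assms by (intro intersection_number_commute) auto
  hence sum_eq: "(\<Sum>i \<in> {1, 2}. \<Sum>j \<in> {1, 2}. p t i j) = p t 1 1 + 2 * p t 1 2 + p t 2 2" by simp
  have p_3: "100000 * p 3 1 1 \<le> k 2" "100000 * p 3 1 2 \<le> k 2" by (simp_all add: p_3_small)
  consider "t = 1" | "t = 2" | "t = 3" using assms by fastforce
  thus ?thesis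
  proof cases
    case 1
    thus ?thesis
      using sum_eq p_111_le p_112_le_mu p_122 mu_small p_3 by simp
  next
    case 2
    have "2 * p 2 2 2 \<le> k 2 + mu" using two_mult_p_222 by linarith
    with 2 show ?thesis
      using sum_eq p_211_le_mu p_212_le_mu mu_small by simp
  next
    case 3
    thus ?thesis
      using sum_eq p_322 mu_small p_3 by simp
  qed
qed

lemma max_common_neighbours_X_12_le: "100 * max_common_neighbours (X {1, 2}) \<le> 51 * k 2"
proof -
  have "max_common_neighbours (X {1, 2}) \<le> 51 * k 2 div 100"
    using sum_intersection_numbers_12_le
    by (intro max_common_neighbours_color_graph_le)
      (auto simp: less_eq_div_iff_mult_less_eq mult.commute)
  thus ?thesis by simp
qed

lemma theta_bounds: "49 / 100 * real (k 2) \<le> \<theta>" "\<theta> \<le> real (k 2) / 2"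
  using mu_small unfolding theta_eq by (simp_all add: field_simps)

lemma theta_coefficient_ge: "48 / 100 * real (k 2) \<le> \<theta> - p 1 1 2 + p 3 1 2"
  using p_112_le_mu mu_small theta_bounds by linarith

lemma joint_eigenvalues_theta_bound:
  assumes "joint_eigenvalues x \<theta>"
  shows "\<bar>x\<bar> \<le> real (k 2) / 100"
proof -
  define b where "b = \<theta> - p 1 1 2 + p 3 1 2"
  have b: "48 / 100 * real (k 2) \<le> b" using theta_coefficient_ge by (simp add: b_def)
  have "\<bar>b * x\<bar> = \<bar>p 2 1 2 * \<theta> - p 3 1 2 * (1 + \<theta>)\<bar>"
    using joint_eigenvalues_mult[OF assms] by (simp add: b_def)
  also have "\<dots> \<le> real (p 2 1 2) * \<theta> + real (p 3 1 2) * (1 + \<theta>)"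
    using theta_bounds(1) k_2_large by (simp add: abs_if)
  also have "\<dots> \<le> real (k 2) / 100000 * real (k 2) + real (k 2) / 100000 * real (k 2)"
    using p_212_le_mu mu_small p_3_small[of 1 2] theta_bounds k_2_large
    by (intro add_mono mult_mono) auto
  also have "\<dots> \<le> 48 / 100 * real (k 2) * (real (k 2) / 100)" by simp
  also have "\<dots> \<le> b * (real (k 2) / 100)" using b by (rule mult_right_mono) simp
  finally have "\<bar>b * x\<bar> \<le> b * (real (k 2) / 100)" .
  moreover have "b > 0" using b k_2_large by linarith
  ultimately show ?thesis by (simp add: abs_mult)
qed

lemma joint_eigenvalues_minus_2_bound:
  assumes "joint_eigenvalues x (- 2)"
  shows "\<bar>x\<bar> \<le> 6 / 10 * real (k 2)"
proof (rule ccontr)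
  assume unbounded: "\<not> ?thesis"
  define K where "K = real (k 2)"
  define a where "a = real (p 1 1 1) - p 3 1 1"
  have x_large: "6 / 10 * K < \<bar>x\<bar>" using unbounded by (simp add: K_def)
  have K: "K \<ge> 100000" using k_2_large by (simp add: K_def)
  have "100000 * p 3 1 1 \<le> k 2" by (rule p_3_small) simp_all
  hence "\<bar>a\<bar> \<le> 51 / 100 * K"
    using p_111_le k_2_large unfolding K_def a_def by linarith
  have "x * x = k 1 + a * x - 2 * real (p 2 1 1) + p 3 1 1"
    using joint_eigenvalues_square[OF assms] by (simp add: a_def algebra_simps)
  also have "\<dots> \<le> 2 * K + a * x"
    using k_1_le_k_2 \<open>100000 * p 3 1 1 \<le> k 2\<close> unfolding K_def by linarith
  also have "a * x \<le> \<bar>a\<bar> * \<bar>x\<bar>" by (metis abs_ge_self abs_mult)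
  also have "\<dots> \<le> 51 / 100 * K * \<bar>x\<bar>" using \<open>\<bar>a\<bar> \<le> 51 / 100 * K\<close> by (rule mult_right_mono) simp
  finally have "\<bar>x\<bar> * (\<bar>x\<bar> - 51 / 100 * K) \<le> 2 * K" by (simp add: algebra_simps)
  moreover have "(6 / 10 * K) * (9 / 100 * K) \<le> \<bar>x\<bar> * (\<bar>x\<bar> - 51 / 100 * K)"
    using x_large K by (intro mult_mono) auto
  moreover have "K * 100000 \<le> K * K" using K by (intro mult_left_mono) auto
  ultimately show False using K by simp
qed

lemma restricted_eigenvalue_X_12_bound:
  assumes "restricted_eigenvalue V (adjacency_operator (X {1, 2})) \<xi>"
  shows "\<bar>\<xi>\<bar> \<le> 61 / 100 * real (k 2)"
proof -
  obtain y g where "restricted_eigenfunction V (adj 1) (\<xi> - y) g"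
      "restricted_eigenfunction V (adj 2) y g" and "y \<in> {- 2, \<theta>}"
    using restricted_eigenfunction_sum_split[of 1 \<xi>] assms
    unfolding restricted_eigenvalue_def restricted_eigenfunction_X_12_iff by auto
  hence joint: "joint_eigenvalues (\<xi> - y) y" by (auto simp: joint_eigenvalues_def)
  from \<open>y \<in> {- 2, \<theta>}\<close> consider "y = - 2" | "y = \<theta>" by blast
  thus ?thesis
  proof cases
    case 1
    with joint have "\<bar>\<xi> - y\<bar> \<le> 6 / 10 * real (k 2)"
      using joint_eigenvalues_minus_2_bound by simp
    with 1 k_2_large show ?thesis by linarith
  next
    case 2
    with joint have "\<bar>\<xi> - y\<bar> \<le> real (k 2) / 100"
      using joint_eigenvalues_theta_bound by simp
    with 2 theta_bounds k_2_large show ?thesis by linarith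
  qed
qed

lemma restricted_eigenvalue_X_12_exists:
  obtains \<xi> where "restricted_eigenvalue V (adjacency_operator (X {1, 2})) \<xi>"
proof -
  obtain f where f: "restricted_eigenfunction V (adj 2) \<theta> f"
    using restricted_eigenvalue_theta[of 1] by (auto simp: restricted_eigenvalue_def)
  have nonzero: "\<theta> - p 1 1 2 + p 3 1 2 \<noteq> 0" using theta_coefficient_ge k_2_large by linarith
  define x where "x = (p 2 1 2 * \<theta> - p 3 1 2 * (1 + \<theta>)) / (\<theta> - p 1 1 2 + p 3 1 2)"
  have "restricted_eigenfunction V (adj 1) x f"
    by (rule restricted_eigenfunction_adj_1[OF f nonzero]) (use nonzero in \<open>simp add: x_def\<close>)
  hence "restricted_eigenfunction V (\<lambda>g u. adj 1 g u + adj 2 g u) (x + \<theta>) f"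
    using f by (rule restricted_eigenfunction_add)
  thus ?thesis
    unfolding restricted_eigenfunction_X_12_iff[symmetric]
    using that restricted_eigenvalue_def by blast
qed

lemma zero_weight_spectral_radius_X_12_le:
  "zero_weight_spectral_radius (X {1, 2}) \<le> 61 / 100 * real (k 2)"
proof -
  interpret regular_graph "X {1, 2}" "k 1 + k 2"
    using regular_graph_color_graph[of "{1, 2}"] by simp
  obtain \<xi> where "restricted_eigenvalue V (adjacency_operator (X {1, 2})) \<xi>"
    by (rule restricted_eigenvalue_X_12_exists)
  thus ?thesis
    using restricted_eigenvalue_X_12_bound by (intro zero_weight_spectral_radius_le[of \<xi>]) auto
qed

end

theorem theorem5p4:
  fixes V :: "'a set" and c :: "'a \<Rightarrow> 'a \<Rightarrow> nat" and \<epsilon> :: real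
  assumes "association_scheme V c 4"
    and "scheme_diameter_2 V c 4"
    and "card V \<ge> 29"
    and "constituent_degree V c 1 \<le> constituent_degree V c 2"
    and "constituent_degree V c 2 \<le> constituent_degree V c 3"
    and "\<epsilon> < 1 / 10 ^ 11"
    and "real (constituent_degree V c 2) \<le> \<epsilon> * real (constituent_degree V c 3) / 2"
    and "real (constituent_degree V c 2) \<le> 101 / 100 * real (constituent_degree V c 1)"
    and "strongly_regular (with_proj (constituent V c 2))"
    and "smallest_eigenvalue (with_proj (constituent V c 2)) = -2"
  shows "real (max_common_neighbours (with_proj (color_graph V c {1, 2})))
      + zero_weight_spectral_radius (with_proj (color_graph V c {1, 2}))
    \<le> 99 / 100 * real (constituent_degree V c 1 + constituent_degree V c 2)"
proof -
  interpret rank4_scheme V c using assms(1) by (simp add: rank4_scheme_def)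
  obtain mu where mu: "\<And>t. \<lbrakk>t < 4; t \<noteq> 0; t \<noteq> 2\<rbrakk> \<Longrightarrow> p t 2 2 = mu"
    using strongly_regular_constituentE[OF assms(9)] by auto
  have minus_2: "restricted_eigenvalue V (adj 2) (- 2)"
    using restricted_eigenvalue_smallest_eigenvalue[of 2] assms(10) by simp
  have p_3_pos: "p 3 i i > 0" if "i \<in> {1, 2}" for i
    using intersection_number_pos_if_diameter_le_2[of i 3] assms(2) that
    unfolding scheme_diameter_2_def by auto
  have "\<epsilon> * real (k 3) \<le> 1 / 10 ^ 11 * real (k 3)" using assms(6) by (intro mult_right_mono) auto
  hence "100000 * k 2 \<le> k 3" using assms(7) by simp
  then interpret dominated_rank4_srg_scheme V c mu
    using mu minus_2 p_3_pos[of 1] p_3_pos[of 2] mu[of 3] assms(4) by unfold_locales auto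
  show ?thesis
    using max_common_neighbours_X_12_le zero_weight_spectral_radius_X_12_le assms(8) by simp
qed

end
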